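(* Let $M$ be a $3$-manifold with a para-CR structure $(X,Y)$. Then $M$ can be locally embedded into $\mathbb R^4=\mathbb R^2_{xy}\times\mathbb R^2_{ab}$ in such a way that the induced para-CR structure coincides with the original one. That is, every point of $M$ has an open neighbourhood $U$ and an embedding $\iota\colon U\to \mathbb R^2_{xy}\times\mathbb R^2_{ab}$ onto a hypersurface $S=\iota(U)$ such that $\iota_*$ maps the direction field of $X$ onto $TS\cap T\mathbb R^2_{xy}$ and the direction field of $Y$ onto $TS\cap T\mathbb R^2_{ab}$.
   Context: All manifolds, functions and vector fields are smooth. A para-CR manifold (para-CR structure) is a $3$-dimensional manifold $M$ with two distinguished direction fields (rank-one distributions), linearly independent at each point and locally spanned by non-vanishing vector fields $X$ and $Y$; only the directions of $X$ and $Y$ matter, i.e. they are defined up to multiplication by non-vanishing functions. $\mathbb R^2_{xy}$ and $\mathbb R^2_{ab}$ denote the planes with coordinates $(x,y)$ and $(a,b)$, and $T\mathbb R^2_{xy}$, $T\mathbb R^2_{ab}$ are the subbundles of $T(\mathbb R^2_{xy}\times\mathbb R^2_{ab})$ spanned by $\partial_x,\partial_y$ and by $\partial_a,\partial_b$ respectively. A hypersurface $S\subset\mathbb R^2_{xy}\times\mathbb R^2_{ab}$ for which $TS\cap T\mathbb R^2_{xy}$ and $TS\cap T\mathbb R^2_{ab}$ are both of rank one has the induced para-CR structure given by these two direction fields, in this order. *)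

theory Defs
  imports "HOL-Analysis.Analysis"
begin

section \<open>Smooth maps between open subsets of normed spaces\<close>

text \<open>On an open subset of a finite-dimensional space, \<open>Ck_on k\<close> is the usual class of \<open>k\<close> times
  continuously differentiable maps. Both predicates are only meant for open sets.\<close>

primrec Ck_on ::
  "nat \<Rightarrow> ('a::real_normed_vector \<Rightarrow> 'b::real_normed_vector) \<Rightarrow> 'a set \<Rightarrow> bool" where
  "Ck_on 0 f S \<longleftrightarrow> continuous_on S f"
| "Ck_on (Suc k) f S \<longleftrightarrow>
     (\<forall>x\<in>S. f differentiable (at x)) \<and> (\<forall>v. Ck_on k (\<lambda>x. frechet_derivative f (at x) v) S)"

definition smooth_on :: "('a::real_normed_vector \<Rightarrow> 'b::real_normed_vector) \<Rightarrow> 'a set \<Rightarrow> bool" where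
  "smooth_on f S \<longleftrightarrow> (\<forall>k. Ck_on k f S)"

section \<open>Smooth manifolds\<close>

text \<open>A chart is a pair of its domain and its coordinate map; the values of the coordinate map
  outside the domain are irrelevant.\<close>

type_synonym ('a, 'n) chart = "'a set \<times> ('a \<Rightarrow> real ^ 'n)"

definition chart_inv :: "('a, 'n) chart \<Rightarrow> real ^ 'n \<Rightarrow> 'a" where
  "chart_inv c = inv_into (fst c) (snd c)"

definition is_chart :: "'a topology \<Rightarrow> ('a, 'n::finite) chart \<Rightarrow> bool" where
  "is_chart M c \<longleftrightarrow>
     openin M (fst c) \<and> open (snd c ` fst c) \<and>
     embedding_map (subtopology M (fst c)) euclidean (snd c)"

text \<open>The atlas need not be maximal; all notions below depend only on the smooth structure
  it generates.\<close>

definition smooth_manifold :: "'a topology \<Rightarrow> ('a, 'n::finite) chart set \<Rightarrow> bool" where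
  "smooth_manifold M A \<longleftrightarrow>
     Hausdorff_space M \<and> second_countable M \<and>
     (\<forall>c\<in>A. is_chart M c) \<and> (\<Union>c\<in>A. fst c) = topspace M \<and>
     (\<forall>c\<in>A. \<forall>d\<in>A. smooth_on (snd d \<circ> chart_inv c) (snd c ` (fst c \<inter> fst d)))"

definition smooth_map_on ::
  "('a, 'n::finite) chart set \<Rightarrow> 'a set \<Rightarrow> ('a \<Rightarrow> 'b::real_normed_vector) \<Rightarrow> bool" where
  "smooth_map_on A U f \<longleftrightarrow> (\<forall>c\<in>A. smooth_on (f \<circ> chart_inv c) (snd c ` (U \<inter> fst c)))"

section \<open>Tangent vectors, vector fields and direction fields\<close>

text \<open>A tangent vector at \<open>p\<close> is the family of its coordinate vectors in all charts around \<open>p\<close>,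
  related by the differentials of the transition maps. The value is fixed to be 0 on all other
  charts, so that equality of tangent vectors is equality of functions; the vector space
  operations are pointwise.\<close>

type_synonym ('a, 'n) tangent_vector = "('a, 'n) chart \<Rightarrow> real ^ 'n"

definition tangent_space ::
  "('a, 'n::finite) chart set \<Rightarrow> 'a \<Rightarrow> ('a, 'n) tangent_vector set" where
  "tangent_space A p = {v.
     (\<forall>c\<in>A. \<forall>d\<in>A. p \<in> fst c \<and> p \<in> fst d \<longrightarrow>
        v d = frechet_derivative (snd d \<circ> chart_inv c) (at (snd c p)) (v c)) \<and>
     (\<forall>c. \<not> (c \<in> A \<and> p \<in> fst c) \<longrightarrow> v c = 0)}"

definition tangent_line :: "('a, 'n::finite) tangent_vector \<Rightarrow> ('a, 'n) tangent_vector set" where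
  "tangent_line v = range (\<lambda>t::real. (\<lambda>c. t *\<^sub>R v c))"

definition smooth_vector_field_on ::
  "('a, 'n::finite) chart set \<Rightarrow> 'a set \<Rightarrow> ('a \<Rightarrow> ('a, 'n) tangent_vector) \<Rightarrow> bool" where
  "smooth_vector_field_on A U X \<longleftrightarrow>
     (\<forall>p\<in>U. X p \<in> tangent_space A p) \<and>
     (\<forall>c\<in>A. smooth_on (\<lambda>x. X (chart_inv c x) c) (snd c ` (U \<inter> fst c)))"

definition direction_field ::
  "'a topology \<Rightarrow> ('a, 'n::finite) chart set \<Rightarrow> ('a \<Rightarrow> ('a, 'n) tangent_vector set) \<Rightarrow> bool" where
  "direction_field M A D \<longleftrightarrow>
     (\<forall>p\<in>topspace M. \<exists>U X. openin M U \<and> p \<in> U \<and> smooth_vector_field_on A U X \<and>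
        (\<forall>q\<in>U. X q \<noteq> (\<lambda>c. 0) \<and> D q = tangent_line (X q)))"

definition para_CR ::
  "'a topology \<Rightarrow> ('a, 3) chart set \<Rightarrow> ('a \<Rightarrow> ('a, 3) tangent_vector set) \<Rightarrow>
     ('a \<Rightarrow> ('a, 3) tangent_vector set) \<Rightarrow> bool" where
  "para_CR M A D E \<longleftrightarrow>
     direction_field M A D \<and> direction_field M A E \<and>
     (\<forall>p\<in>topspace M. D p \<inter> E p = {\<lambda>c. 0})"

section \<open>Embeddings into Euclidean spaces\<close>

text \<open>On elements of \<open>tangent_space A p\<close> the result does not depend on the chosen chart.\<close>

definition differential ::
  "('a, 'n::finite) chart set \<Rightarrow> ('a \<Rightarrow> 'b::real_normed_vector) \<Rightarrow> 'a \<Rightarrow>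
     ('a, 'n) tangent_vector \<Rightarrow> 'b" where
  "differential A f p v =
     (let c = (SOME c. c \<in> A \<and> p \<in> fst c)
      in frechet_derivative (f \<circ> chart_inv c) (at (snd c p)) (v c))"

definition smooth_embedding_on ::
  "'a topology \<Rightarrow> ('a, 'n::finite) chart set \<Rightarrow> 'a set \<Rightarrow> ('a \<Rightarrow> 'b::euclidean_space) \<Rightarrow> bool" where
  "smooth_embedding_on M A U f \<longleftrightarrow>
     smooth_map_on A U f \<and>
     (\<forall>p\<in>U. inj_on (differential A f p) (tangent_space A p)) \<and>
     embedding_map (subtopology M U) euclidean f"

section \<open>Hypersurfaces and their induced para-CR structures\<close>

definition hypersurface :: "'b::euclidean_space set \<Rightarrow> bool" where
  "hypersurface S \<longleftrightarrow>
     (\<forall>q\<in>S. \<exists>W F. open W \<and> q \<in> W \<and> smooth_on (F :: 'b \<Rightarrow> real) W \<and>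
        (\<forall>x\<in>W. frechet_derivative F (at x) \<noteq> (\<lambda>v. 0)) \<and>
        S \<inter> W = {x \<in> W. F x = 0})"

text \<open>Velocities at \<open>q\<close> of smooth curves in \<open>S\<close>.\<close>

definition tangent_space_of :: "'b::euclidean_space set \<Rightarrow> 'b \<Rightarrow> 'b set" where
  "tangent_space_of S q = {w. \<exists>e>0. \<exists>\<gamma>::real \<Rightarrow> 'b.
     smooth_on \<gamma> {-e<..<e} \<and> \<gamma> ` {-e<..<e} \<subseteq> S \<and> \<gamma> 0 = q \<and>
     (\<gamma> has_vector_derivative w) (at 0)}"

text \<open>The first factor of \<open>(real ^ 2) \<times> (real ^ 2)\<close> is the \<open>(x, y)\<close>-plane, the second one the
  \<open>(a, b)\<close>-plane.\<close>

definition T_xy :: "((real ^ 2) \<times> (real ^ 2)) set" where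
  "T_xy = UNIV \<times> {0}"

definition T_ab :: "((real ^ 2) \<times> (real ^ 2)) set" where
  "T_ab = {0} \<times> UNIV"

definition induced_xy ::
  "((real ^ 2) \<times> (real ^ 2)) set \<Rightarrow> ((real ^ 2) \<times> (real ^ 2)) \<Rightarrow> ((real ^ 2) \<times> (real ^ 2)) set" where
  "induced_xy S q = tangent_space_of S q \<inter> T_xy"

definition induced_ab ::
  "((real ^ 2) \<times> (real ^ 2)) set \<Rightarrow> ((real ^ 2) \<times> (real ^ 2)) \<Rightarrow> ((real ^ 2) \<times> (real ^ 2)) set" where
  "induced_ab S q = tangent_space_of S q \<inter> T_ab"

definition has_induced_para_CR :: "((real ^ 2) \<times> (real ^ 2)) set \<Rightarrow> bool" where
  "has_induced_para_CR S \<longleftrightarrow>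
     hypersurface S \<and> (\<forall>q\<in>S. dim (induced_xy S q) = 1 \<and> dim (induced_ab S q) = 1)"

end

theory Submission
  imports Defs
begin


text \<open>Locally a non-vanishing vector field on a 3-manifold has two independent first integrals. If
  \<open>(a, b)\<close> are first integrals of \<open>X\<close> and \<open>(x, y)\<close> first integrals of \<open>Y\<close>, then \<open>(x, y, a, b)\<close> is an
  immersion because the kernels of \<open>d(a, b)\<close> and \<open>d(x, y)\<close>, spanned by \<open>X\<close> and \<open>Y\<close>, meet only in 0;
  it sends \<open>X\<close> into the \<open>(x, y)\<close>-plane and \<open>Y\<close> into the \<open>(a, b)\<close>-plane. The first integrals come from
  the flow, whose smoothness is obtained by differentiating the integral equation \<open>u = z + K (F u)\<close>:
  its derivative solves a linear equation whose coefficients are as smooth as \<open>u\<close>, so the regularity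
  can be bootstrapped.\<close>

section \<open>Calculus of smooth maps\<close>

text \<open>Smoothness needs one neighbourhood for all orders at once, so no step of the bootstrap
  may shrink it. None does: each differentiated equation keeps the same operator in front of its
  unknown, and only the inhomogeneous term changes. The condition \<open>d * L \<le> 1/2\<close>,
  where \<open>L\<close> bounds this operator, makes the equations contractive and therefore serves
  for every \<open>k\<close>. Differences are written exactly, as an averaged derivative applied to
  the increment. So the difference of the solutions started at two points solves a linear equation
  over the doubled space \<open>Z \<times> Z\<close>. Difference quotients live there, and
  differentiability becomes continuity up to the diagonal. Dividing the vector field by a linear
  functional of it makes the arrival time at the hyperplane an affine function of the starting
  point, so the first integrals are compositions of the flow with explicit maps. The immersion is
  finally restricted until its image is a graph, which yields the defining function of the
  hypersurface, the continuous inverse and the tangent spaces together.\<close>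

lemma Ck_on_cong_imp:
  assumes "open S" "Ck_on k f S" "\<And>x. x \<in> S \<Longrightarrow> f x = g x"
  shows "Ck_on k g S"
  using assms(2,3)
proof (induction k arbitrary: f g)
  case 0
  then show ?case by (simp cong: continuous_on_cong)
next
  case (Suc k)
  have f: "(f has_derivative frechet_derivative f (at x)) (at x)" if "x \<in> S" for x
    using Suc.prems(1) that frechet_derivative_works by auto
  have g: "(g has_derivative frechet_derivative f (at x)) (at x)" if "x \<in> S" for x
    by (rule has_derivative_transform_within_open[OF f[OF that] assms(1) that Suc.prems(2)])
  have "Ck_on k (\<lambda>x. frechet_derivative g (at x) v) S" for v
  proof (rule Suc.IH)
    show "Ck_on k (\<lambda>x. frechet_derivative f (at x) v) S"
      using Suc.prems(1) by simp
  qed (simp add: frechet_derivative_at[OF g])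
  then show ?case using g by (auto simp: differentiable_def)
qed

lemma Ck_on_cong:
  assumes "open S" "\<And>x. x \<in> S \<Longrightarrow> f x = g x"
  shows "Ck_on k f S \<longleftrightarrow> Ck_on k g S"
  using Ck_on_cong_imp[OF assms(1), of k f g] Ck_on_cong_imp[OF assms(1), of k g f] assms(2) by force

lemma Ck_on_subset: "Ck_on k f S \<Longrightarrow> T \<subseteq> S \<Longrightarrow> Ck_on k f T"
  by (induction k arbitrary: f) (auto intro: continuous_on_subset)

text \<open>\<open>frechet_derivative\<close> is a choice operator; the inductions on
  \<open>k\<close> run on explicit derivative formulas such as the product and chain rules, which
  enter here.\<close>

lemma Ck_on_SucI:
  assumes "open S" "\<And>x. x \<in> S \<Longrightarrow> (f has_derivative f' x) (at x)"
    and "\<And>v. Ck_on k (\<lambda>x. f' x v) S"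
  shows "Ck_on (Suc k) f S"
proof -
  have "frechet_derivative f (at x) = f' x" if "x \<in> S" for x
    using assms(2)[OF that] frechet_derivative_at by metis
  then have "Ck_on k (\<lambda>x. frechet_derivative f (at x) v) S" for v
    using Ck_on_cong[OF assms(1), of "\<lambda>x. f' x v" "\<lambda>x. frechet_derivative f (at x) v" k] assms(3)
    by metis
  then show ?thesis
    using assms(2) by (auto simp: differentiable_def)
qed

lemma Ck_on_has_derivative:
  "Ck_on (Suc k) f S \<Longrightarrow> x \<in> S \<Longrightarrow> (f has_derivative frechet_derivative f (at x)) (at x)"
  using frechet_derivative_works by auto

lemma Ck_on_SucD: "Ck_on (Suc k) f S \<Longrightarrow> Ck_on k f S"
proof (induction k arbitrary: f)
  case 0
  then show ?case
    by (auto intro!: continuous_at_imp_continuous_on differentiable_imp_continuous_within)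
next
  case (Suc k)
  then show ?case
    by (metis Ck_on.simps(2))
qed

lemma Ck_on_continuous: "Ck_on k f S \<Longrightarrow> continuous_on S f"
  by (induction k) (use Ck_on_SucD in auto)

lemma Ck_on_const: "Ck_on k (\<lambda>x. c) S"
  by (induction k arbitrary: c) (auto simp: frechet_derivative_const)

lemma Ck_on_bounded_linear:
  assumes "bounded_linear L" "open S" "Ck_on k f S"
  shows "Ck_on k (\<lambda>x. L (f x)) S"
  using assms(3)
proof (induction k arbitrary: f)
  case 0
  then show ?case using assms(1) by (simp add: bounded_linear.continuous_on)
next
  case (Suc k)
  show ?case
  proof (rule Ck_on_SucI[OF assms(2)])
    show "((\<lambda>x. L (f x)) has_derivative (\<lambda>v. L (frechet_derivative f (at x) v))) (at x)"
      if "x \<in> S" for x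
      by (rule bounded_linear.has_derivative[OF assms(1) Ck_on_has_derivative[OF Suc.prems that]])
    show "Ck_on k (\<lambda>x. L (frechet_derivative f (at x) v)) S" for v
      using Suc.prems by (intro Suc.IH) auto
  qed
qed

lemma Ck_on_ident: "Ck_on k (\<lambda>x. x) S"
  by (cases k) (auto simp: Ck_on_const)

lemma Ck_on_linear: "bounded_linear L \<Longrightarrow> Ck_on k L S"
  using Ck_on_subset[OF Ck_on_bounded_linear[OF _ open_UNIV Ck_on_ident]] by auto

lemma Ck_on_add:
  assumes "open S" "Ck_on k f S" "Ck_on k g S"
  shows "Ck_on k (\<lambda>x. f x + g x) S"
  using assms(2,3)
proof (induction k arbitrary: f g)
  case 0
  then show ?case by (simp add: continuous_on_add)
next
  case (Suc k)
  show ?case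
  proof (rule Ck_on_SucI[OF assms(1)])
    show "((\<lambda>x. f x + g x) has_derivative
        (\<lambda>v. frechet_derivative f (at x) v + frechet_derivative g (at x) v)) (at x)"
      if "x \<in> S" for x
      using Suc.prems that by (intro has_derivative_add Ck_on_has_derivative)
    show "Ck_on k (\<lambda>x. frechet_derivative f (at x) v + frechet_derivative g (at x) v) S" for v
      using Suc.prems by (intro Suc.IH) auto
  qed
qed

lemma Ck_on_bilinear:
  assumes "bounded_bilinear B" "open S" "Ck_on k f S" "Ck_on k g S"
  shows "Ck_on k (\<lambda>x. B (f x) (g x)) S"
  using assms(3,4)
proof (induction k arbitrary: f g)
  case 0
  then show ?case using assms(1) by (simp add: bounded_bilinear.continuous_on)
next
  case (Suc k)
  \<comment> \<open>The product rule leaves one factor undifferentiated in each summand, so the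
    induction hypothesis also needs \<open>f\<close> and \<open>g\<close> as maps of class
    \<open>k\<close>.\<close>
  note Sk = Ck_on_SucD[OF Suc.prems(1)] Ck_on_SucD[OF Suc.prems(2)]
  show ?case
  proof (rule Ck_on_SucI[OF assms(2)])
    show "((\<lambda>x. B (f x) (g x)) has_derivative
        (\<lambda>v. B (f x) (frechet_derivative g (at x) v) + B (frechet_derivative f (at x) v) (g x))) (at x)"
      if "x \<in> S" for x
      using Suc.prems that assms(1)
      by (intro bounded_bilinear.FDERIV Ck_on_has_derivative)
    show "Ck_on k (\<lambda>x. B (f x) (frechet_derivative g (at x) v) +
                       B (frechet_derivative f (at x) v) (g x)) S" for v
      using Suc.prems Sk by (intro Ck_on_add assms(2) Suc.IH) auto
  qed
qed

lemma Ck_on_sum: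
  assumes "open S" "\<And>i. i \<in> I \<Longrightarrow> Ck_on k (f i) S"
  shows "Ck_on k (\<lambda>x. \<Sum>i\<in>I. f i x) S"
  using assms(2)
  by (induction I rule: infinite_finite_induct) (auto simp: Ck_on_const intro: Ck_on_add[OF assms(1)])

lemma Ck_on_prod:
  fixes f :: "'i \<Rightarrow> 'a::real_normed_vector \<Rightarrow> real"
  assumes "open S" "\<And>i. i \<in> I \<Longrightarrow> Ck_on k (f i) S"
  shows "Ck_on k (\<lambda>x. \<Prod>i\<in>I. f i x) S"
  using assms(2)
  by (induction I rule: infinite_finite_induct)
    (auto simp: Ck_on_const intro: Ck_on_bilinear[OF bounded_bilinear_mult assms(1)])

lemma Ck_on_uminus: "open S \<Longrightarrow> Ck_on k f S \<Longrightarrow> Ck_on k (\<lambda>x. - f x) S"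
  using Ck_on_bounded_linear[OF bounded_linear_minus[OF bounded_linear_ident]] by auto

lemma Ck_on_diff: "open S \<Longrightarrow> Ck_on k f S \<Longrightarrow> Ck_on k g S \<Longrightarrow> Ck_on k (\<lambda>x. f x - g x) S"
  using Ck_on_add[of S k f "\<lambda>x. - g x"] Ck_on_uminus[of S k g] by simp

lemma Ck_on_scaleR:
  "open S \<Longrightarrow> Ck_on k f S \<Longrightarrow> Ck_on k g S \<Longrightarrow> Ck_on k (\<lambda>x. f x *\<^sub>R g x) S"
  by (rule Ck_on_bilinear[OF bounded_bilinear_scaleR])

lemma Ck_on_mult:
  fixes f g :: "'a::real_normed_vector \<Rightarrow> real"
  shows "open S \<Longrightarrow> Ck_on k f S \<Longrightarrow> Ck_on k g S \<Longrightarrow> Ck_on k (\<lambda>x. f x * g x) S"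
  by (rule Ck_on_bilinear[OF bounded_bilinear_mult])

text \<open>The derivative of the reciprocal is a polynomial in the reciprocal and the derivative of
  \<open>f\<close>, so the order already known for the reciprocal feeds the next one.\<close>

lemma Ck_on_inverse:
  fixes f :: "'a::real_normed_vector \<Rightarrow> real"
  assumes "open S" "Ck_on k f S" "\<And>x. x \<in> S \<Longrightarrow> f x \<noteq> 0"
  shows "Ck_on k (\<lambda>x. inverse (f x)) S"
  using assms(2)
proof (induction k)
  case 0
  then show ?case using assms(3) by (auto intro: continuous_on_inverse)
next
  case (Suc k)
  have IH: "Ck_on k (\<lambda>x. inverse (f x)) S"
    using Suc.IH Ck_on_SucD[OF Suc.prems] by blast
  show ?case
  proof (rule Ck_on_SucI[OF assms(1)])
    show "((\<lambda>x. inverse (f x)) has_derivative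
        (\<lambda>v. - (inverse (f x) * frechet_derivative f (at x) v * inverse (f x)))) (at x)"
      if "x \<in> S" for x
      using Deriv.has_derivative_inverse[OF assms(3)[OF that] Ck_on_has_derivative[OF Suc.prems that]] .
    show "Ck_on k (\<lambda>x. - (inverse (f x) * frechet_derivative f (at x) v * inverse (f x))) S" for v
      using Suc.prems by (intro Ck_on_uminus Ck_on_mult assms(1) IH) auto
  qed
qed

lemma Ck_on_Pair:
  assumes "open S" "Ck_on k f S" "Ck_on k g S"
  shows "Ck_on k (\<lambda>x. (f x, g x)) S"
proof -
  have "Ck_on k (\<lambda>x. (f x, 0) + (0, g x)) S"
    using assms
    by (intro Ck_on_add Ck_on_bounded_linear[where L = "\<lambda>y. (y, 0)"]
        Ck_on_bounded_linear[where L = "\<lambda>y. (0, y)"])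
      (auto intro!: bounded_linear_Pair bounded_linear_ident bounded_linear_zero)
  then show ?thesis by simp
qed

section \<open>Chain rule and operator-valued maps\<close>

lemma linear_Basis_expansion:
  fixes L :: "'a::euclidean_space \<Rightarrow> 'b::real_vector"
  assumes "linear L"
  shows "L v = (\<Sum>i\<in>Basis. (v \<bullet> i) *\<^sub>R L i)"
proof -
  have "L v = L (\<Sum>i\<in>Basis. (v \<bullet> i) *\<^sub>R i)" by (simp add: euclidean_representation)
  also have "\<dots> = (\<Sum>i\<in>Basis. (v \<bullet> i) *\<^sub>R L i)"
    by (simp add: linear_sum[OF assms] linear_cmul[OF assms])
  finally show ?thesis .
qed

text \<open>In the chain rule the outer derivative is taken in the direction \<open>?f' x v\<close>,
  which moves with \<open>x\<close>, whereas \<open>Ck_on\<close> speaks about fixed directions.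
  Expanding along \<open>Basis\<close> leaves finitely many fixed directions whose coefficients are
  functions of \<open>x\<close>; hence the Euclidean middle space.\<close>

lemma Ck_on_compose:
  fixes g :: "'b::euclidean_space \<Rightarrow> 'c::real_normed_vector"
  assumes "open S" "Ck_on k f S" "Ck_on k g T" "f ` S \<subseteq> T"
  shows "Ck_on k (\<lambda>x. g (f x)) S"
  using assms(2,3)
proof (induction k arbitrary: g)
  case 0
  then show ?case using assms(4) by (auto intro: continuous_on_compose2)
next
  case (Suc k)
  have fS: "f x \<in> T" if "x \<in> S" for x using assms(4) that by auto
  let ?f' = "\<lambda>x. frechet_derivative f (at x)" and ?g' = "\<lambda>y. frechet_derivative g (at y)"
  show ?case
  proof (rule Ck_on_SucI[OF assms(1)])
    show "((\<lambda>x. g (f x)) has_derivative (\<lambda>v. \<Sum>i\<in>Basis. (?f' x v \<bullet> i) *\<^sub>R ?g' (f x) i)) (at x)"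
      if "x \<in> S" for x
    proof -
      have g: "(g has_derivative ?g' (f x)) (at (f x))"
        using Suc.prems(2) fS[OF that] by (rule Ck_on_has_derivative)
      have "((\<lambda>x. g (f x)) has_derivative (\<lambda>v. ?g' (f x) (?f' x v))) (at x)"
        using has_derivative_compose[OF Ck_on_has_derivative[OF Suc.prems(1) that] g] .
      also have "(\<lambda>v. ?g' (f x) (?f' x v)) = (\<lambda>v. \<Sum>i\<in>Basis. (?f' x v \<bullet> i) *\<^sub>R ?g' (f x) i)"
        by (rule ext, rule linear_Basis_expansion[OF has_derivative_linear[OF g]])
      finally show ?thesis .
    qed
    show "Ck_on k (\<lambda>x. \<Sum>i\<in>Basis. (?f' x v \<bullet> i) *\<^sub>R ?g' (f x) i) S" for v
      using Suc.prems Ck_on_SucD[OF Suc.prems(1)]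
      by (intro Ck_on_sum Ck_on_scaleR assms(1) Suc.IH
          Ck_on_bounded_linear[OF bounded_linear_inner_left]) auto
  qed
qed

text \<open>On a Euclidean domain an operator is a finite sum of rank-one operators built from its
  values on \<open>Basis\<close>: \<open>E i c\<close> sends \<open>v\<close> to
  \<open>(v \<bullet> i) *\<^sub>R c\<close> and is linear in \<open>c\<close>. Regularity of the
  values thus becomes regularity in the operator norm.\<close>

lemma Ck_on_blinfun:
  fixes f :: "'a::real_normed_vector \<Rightarrow> 'b::euclidean_space \<Rightarrow>\<^sub>L 'c::real_normed_vector"
  assumes "open S" "\<And>v. Ck_on k (\<lambda>x. f x v) S"
  shows "Ck_on k f S"
proof -
  define E where "E i c = blinfun_scaleR_left c o\<^sub>L blinfun_inner_left i" for i :: 'b and c :: 'c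
  have E: "bounded_linear (E i)" for i
    unfolding E_def
    by (intro bounded_linear_compose[OF bounded_bilinear.bounded_linear_left[OF
          bounded_bilinear_blinfun_compose] bounded_linear_blinfun_scaleR_left])
  have "f x = (\<Sum>i\<in>Basis. E i (f x i))" for x
  proof (rule blinfun_eqI)
    fix v
    have "f x v = (\<Sum>i\<in>Basis. (v \<bullet> i) *\<^sub>R f x i)"
      by (rule linear_Basis_expansion[OF bounded_linear.linear[OF blinfun.bounded_linear_right]])
    then show "f x v = (\<Sum>i\<in>Basis. E i (f x i)) v"
      by (simp add: E_def blinfun.sum_left blinfun_inner_left.rep_eq)
  qed
  moreover have "Ck_on k (\<lambda>x. \<Sum>i\<in>Basis. E i (f x i)) S"
    using assms by (intro Ck_on_sum Ck_on_bounded_linear[OF E])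
  ultimately show ?thesis by simp
qed

text \<open>The derivative as a point of a normed space of operators, so that its continuity, norm
  and integrals make sense. It is meaningful where \<open>f\<close> is differentiable, since there
  the wrapped function is bounded linear.\<close>

definition fderiv :: "('a::real_normed_vector \<Rightarrow> 'b::real_normed_vector) \<Rightarrow> 'a \<Rightarrow> 'a \<Rightarrow>\<^sub>L 'b" where
  "fderiv f x = Blinfun (frechet_derivative f (at x))"

lemma fderiv_apply:
  "f differentiable (at x) \<Longrightarrow> blinfun_apply (fderiv f x) = frechet_derivative f (at x)"
  unfolding fderiv_def
  by (intro bounded_linear_Blinfun_apply has_derivative_bounded_linear[where f = f and F = "at x"])
    (simp add: frechet_derivative_works[symmetric])

lemma fderiv_has_derivative:
  "Ck_on (Suc k) f S \<Longrightarrow> x \<in> S \<Longrightarrow> (f has_derivative blinfun_apply (fderiv f x)) (at x)"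
  using Ck_on_has_derivative[of k f S x] by (auto simp: fderiv_apply)

lemma Ck_on_fderiv:
  fixes f :: "'a::euclidean_space \<Rightarrow> 'b::real_normed_vector"
  assumes "open S" "Ck_on (Suc k) f S"
  shows "Ck_on k (fderiv f) S"
proof (rule Ck_on_blinfun[OF assms(1)])
  fix v
  have "Ck_on k (\<lambda>x. frechet_derivative f (at x) v) S" using assms(2) by simp
  then show "Ck_on k (\<lambda>x. fderiv f x v) S"
    by (rule Ck_on_cong_imp[OF assms(1)]) (use assms(2) in \<open>simp add: fderiv_apply\<close>)
qed


section \<open>Integral equations along time paths\<close>

text \<open>For \<open>p = (t, z)\<close> this is the integral of \<open>g\<close> from \<open>(0, z)\<close> to \<open>(t, z)\<close>, rescaled to \<open>[0, 1]\<close> so that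
  it has the right sign for negative \<open>t\<close>.\<close>

definition kint :: "(real \<times> 'z \<Rightarrow> 'e::banach) \<Rightarrow> real \<times> 'z \<Rightarrow> 'e" where
  "kint g p = fst p *\<^sub>R integral {0..1} (\<lambda>s. g (s * fst p, snd p))"

lemma path_mem:
  assumes "p \<in> ball 0 d \<times> Z" "s \<in> {0..1::real}"
  shows "(s * fst p, snd p) \<in> ball 0 d \<times> Z"
proof -
  have "\<bar>s * fst p\<bar> \<le> \<bar>fst p\<bar>"
    using assms(2) by (simp add: abs_mult mult_left_le_one_le)
  then show ?thesis using assms(1) by (auto simp: dist_norm)
qed

lemma continuous_on_path:
  fixes g :: "real \<times> 'z::topological_space \<Rightarrow> 'e::topological_space"
  assumes "continuous_on (ball 0 d \<times> Z) g" "p \<in> ball 0 d \<times> Z"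
  shows "continuous_on {0..1} (\<lambda>s. g (s * fst p, snd p))"
  using path_mem[OF assms(2)]
  by (intro continuous_on_compose2[OF assms(1)] continuous_intros) blast

lemma kint_cong:
  assumes "\<And>s. s \<in> {0..1} \<Longrightarrow> f (s * fst p, snd p) = g (s * fst p, snd p)"
  shows "kint f p = kint g p"
  unfolding kint_def using assms by (metis (no_types, lifting) integral_cong)

lemma kint_zero_time: "kint g (0, z) = 0"
  by (simp add: kint_def)

lemma kint_continuous:
  fixes g :: "real \<times> 'z::metric_space \<Rightarrow> 'e::banach"
  assumes "continuous_on (ball 0 d \<times> Z) g"
  shows "continuous_on (ball 0 d \<times> Z) (kint g)"
proof -
  let ?P = "ball (0::real) d \<times> Z"
  have "continuous_on (?P \<times> cbox 0 1) (\<lambda>(p, s). g (s * fst p, snd p))"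
    unfolding split_beta
    using path_mem[of _ d Z]
    by (intro continuous_on_compose2[OF assms] continuous_intros) auto
  then have "continuous_on ?P (\<lambda>p. integral (cbox 0 1) (\<lambda>s. g (s * fst p, snd p)))"
    by (rule integral_continuous_on_param)
  then show ?thesis
    unfolding kint_def by (auto intro!: continuous_intros)
qed

lemma norm_kint_le:
  fixes g :: "real \<times> 'z::metric_space \<Rightarrow> 'e::banach"
  assumes "continuous_on (ball 0 d \<times> Z) g" "p \<in> ball 0 d \<times> Z"
    and "\<And>s. s \<in> {0..1} \<Longrightarrow> norm (g (s * fst p, snd p)) \<le> B"
  shows "norm (kint g p) \<le> \<bar>fst p\<bar> * B"
  using integral_bound[OF _ continuous_on_path[OF assms(1,2)] assms(3)]
  by (auto simp: kint_def intro!: mult_left_mono)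

lemma kint_add:
  fixes f g :: "real \<times> 'z::metric_space \<Rightarrow> 'e::banach"
  assumes "continuous_on (ball 0 d \<times> Z) f" "continuous_on (ball 0 d \<times> Z) g" "p \<in> ball 0 d \<times> Z"
  shows "kint (\<lambda>q. f q + g q) p = kint f p + kint g p"
  unfolding kint_def
  using continuous_on_path[OF assms(1,3)] continuous_on_path[OF assms(2,3)]
  by (simp add: integral_add integrable_continuous_real scaleR_add_right)

lemma kint_diff:
  fixes f g :: "real \<times> 'z::metric_space \<Rightarrow> 'e::banach"
  assumes "continuous_on (ball 0 d \<times> Z) f" "continuous_on (ball 0 d \<times> Z) g" "p \<in> ball 0 d \<times> Z"
  shows "kint (\<lambda>q. f q - g q) p = kint f p - kint g p"
  unfolding kint_def
  using continuous_on_path[OF assms(1,3)] continuous_on_path[OF assms(2,3)]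
  by (simp add: integral_diff integrable_continuous_real scaleR_diff_right)

text \<open>The relation between \<open>f\<close> and \<open>g\<close> is asked only along the path
  of \<open>p\<close>. Hence \<open>h\<close> may be evaluation at a vector that depends on
  \<open>snd p\<close>, which is constant on that path.\<close>

lemma kint_linear:
  fixes g :: "real \<times> 'z::metric_space \<Rightarrow> 'e::banach" and h :: "'e \<Rightarrow> 'f::banach"
  assumes "bounded_linear h" "continuous_on (ball 0 d \<times> Z) g" "p \<in> ball 0 d \<times> Z"
    and "\<And>s. s \<in> {0..1} \<Longrightarrow> f (s * fst p, snd p) = h (g (s * fst p, snd p))"
  shows "kint f p = h (kint g p)"
proof -
  have "kint f p = kint (\<lambda>q. h (g q)) p"
    using assms(4) by (rule kint_cong)
  also have "\<dots> = h (kint g p)"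
    using integral_linear[OF integrable_continuous_real[OF continuous_on_path[OF assms(2,3)]] assms(1)]
    by (simp add: kint_def o_def linear_cmul[OF bounded_linear.linear[OF assms(1)]])
  finally show ?thesis .
qed

lemma kint_FTC:
  fixes h :: "real \<times> 'z::metric_space \<Rightarrow> 'e::banach"
  assumes "\<And>t z. (t, z) \<in> ball 0 d \<times> Z \<Longrightarrow>
      ((\<lambda>t. h (t, z)) has_vector_derivative h' (t, z)) (at t)"
    and "(t, z) \<in> ball 0 d \<times> Z"
  shows "h (t, z) - h (0, z) = kint h' (t, z)"
proof -
  have "((\<lambda>s. t *\<^sub>R h' (s * t, z)) has_integral h (1 * t, z) - h (0 * t, z)) {0..1}"
  proof (rule fundamental_theorem_of_calculus)
    fix s :: real assume "s \<in> {0..1}"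
    then have "((\<lambda>t. h (t, z)) has_vector_derivative h' (s * t, z)) (at (s * t))"
      using path_mem[OF assms(2)] assms(1) by auto
    then have "((\<lambda>t. h (t, z)) \<circ> (\<lambda>s. s * t) has_vector_derivative t *\<^sub>R h' (s * t, z)) (at s)"
      by (intro vector_diff_chain_at) (auto intro!: derivative_eq_intros simp: has_vector_derivative_def)
    then show "((\<lambda>s. h (s * t, z)) has_vector_derivative t *\<^sub>R h' (s * t, z)) (at s within {0..1})"
      by (simp add: o_def has_vector_derivative_at_within)
  qed simp
  from integral_unique[OF this] show ?thesis by (simp add: kint_def)
qed

text \<open>Because of the rescaling, \<open>t\<close> occurs inside the integrand of
  \<open>kint\<close>. Near \<open>t\<close> it is therefore compared with an ordinary indefinite
  integral \<open>G\<close>, whose derivative is known.\<close>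

lemma kint_has_time_derivative:
  fixes g :: "real \<times> 'z::metric_space \<Rightarrow> 'e::banach"
  assumes "continuous_on (ball 0 d \<times> Z) g" "(t, z) \<in> ball 0 d \<times> Z"
  shows "((\<lambda>t. kint g (t, z)) has_vector_derivative g (t, z)) (at t)"
proof -
  \<comment> \<open>With this \<open>c\<close> both \<open>0\<close> and \<open>t\<close> are
    interior to \<open>{-c..c}\<close>; the arbitrary base point \<open>-c\<close> cancels in
    \<open>G u - G 0\<close>.\<close>
  obtain c where c: "\<bar>t\<bar> < c" "c < d"
    using assms(2) dense[of "\<bar>t\<bar>" d] by (auto simp: dist_norm)
  define G where "G u = integral {-c..u} (\<lambda>s. g (s, z))" for u
  have "continuous_on {-c..c} (\<lambda>s. g (s, z))"
    using c assms(2) by (intro continuous_on_compose2[OF assms(1)] continuous_intros) (auto simp: dist_norm)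
  note G0 = integral_has_vector_derivative[OF this, folded G_def]
  have G: "(G has_vector_derivative g (u, z)) (at u)" if "u \<in> ball 0 c" for u
  proof -
    have u: "u \<in> {-c<..<c}" using that by (auto simp: dist_norm)
    then have "(G has_vector_derivative g (u, z)) (at u within {-c..c})"
      by (intro G0) simp
    moreover have "at u within {-c..c} = at u"
      using u by (intro at_within_interior) (simp add: interior_atLeastAtMost_real)
    ultimately show ?thesis by simp
  qed
  have eq: "G u - G 0 = kint g (u, z)" if "u \<in> ball 0 c" for u
  proof -
    have "(case (u, z) of (t, z) \<Rightarrow> G t) - (case (0, z) of (t, z) \<Rightarrow> G t) = kint g (u, z)"
      by (rule kint_FTC[where d = c and Z = "{z}"]) (use G that in auto)
    then show ?thesis by simp
  qed
  have "((\<lambda>u. G u - G 0) has_vector_derivative g (t, z) - 0) (at t)"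
    using c by (intro has_vector_derivative_diff G has_vector_derivative_const) (simp add: dist_norm)
  then have "((\<lambda>u. G u - G 0) has_vector_derivative g (t, z)) (at t)" by simp
  then show ?thesis
  proof (rule has_vector_derivative_transform_within_open)
    show "t \<in> ball 0 c" using c by (simp add: dist_norm)
  qed (use eq in simp_all)
qed

text \<open>Let \<open>m\<close> be the maximum of the norm of \<open>y\<close> on the compact path
  from time 0 to \<open>p\<close>. Where it is attained, the equation gives
  \<open>m \<le> d * L * m \<le> m / 2\<close>. The maximum over a single path exists even if
  \<open>y\<close> is unbounded on the whole domain.\<close>

lemma kint_unique:
  fixes y :: "real \<times> 'z::metric_space \<Rightarrow> 'e::banach"
  assumes "continuous_on (ball 0 d \<times> Z) y" "continuous_on (ball 0 d \<times> Z) A"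
    and "\<And>p. p \<in> ball 0 d \<times> Z \<Longrightarrow> norm (A p) \<le> L" "d * L \<le> 1/2" "0 \<le> L"
    and "\<And>p. p \<in> ball 0 d \<times> Z \<Longrightarrow> y p = kint (\<lambda>q. blinfun_apply (A q) (y q)) p"
    and "p \<in> ball 0 d \<times> Z"
  shows "y p = 0"
proof -
  let ?P = "ball (0::real) d \<times> Z"
  let ?q = "\<lambda>s. (s * fst p, snd p)"
  obtain s where s: "s \<in> {0..1}" "\<And>s'. s' \<in> {0..1} \<Longrightarrow> norm (y (?q s')) \<le> norm (y (?q s))"
    using continuous_attains_sup[of "{0..1::real}" "\<lambda>s. norm (y (?q s))"]
      continuous_on_norm[OF continuous_on_path[OF assms(1,7)]] by auto
  let ?m = "norm (y (?q s))"
  have q: "?q s \<in> ?P" using path_mem[OF assms(7) s(1)] .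
  have "?m \<le> \<bar>fst (?q s)\<bar> * (L * ?m)"
    unfolding assms(6)[OF q]
  proof (rule norm_kint_le[OF _ q])
    show "continuous_on ?P (\<lambda>q. A q (y q))"
      using assms(1,2) by (intro continuous_intros)
    fix r :: real assume r: "r \<in> {0..1}"
    let ?x = "(r * fst (?q s), snd (?q s))"
    have x: "?x \<in> ?P" using path_mem[OF q r] by simp
    \<comment> \<open>The path of \<open>?q s\<close> is an initial piece of the path of
      \<open>p\<close>, so the maximality of \<open>s\<close> applies to it.\<close>
    have "r * s \<in> {0..1}" using r s(1) by (simp add: mult_le_one)
    from s(2)[OF this] have "norm (y ?x) \<le> ?m" by (simp add: mult.assoc)
    then have "norm (A ?x (y ?x)) \<le> L * ?m"
      using norm_blinfun[of "A ?x" "y ?x"] assms(3)[OF x] assms(5)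
      by (meson mult_mono norm_ge_zero order_trans)
    then show "norm (A ?x (y ?x)) \<le> L * norm (kint (\<lambda>q. A q (y q)) (?q s))"
      using assms(6)[OF q] by simp
  qed
  also have "\<dots> \<le> d * (L * ?m)"
    using q assms(5) by (intro mult_right_mono) (auto simp: dist_norm)
  also have "\<dots> \<le> 1/2 * ?m"
    using mult_right_mono[OF assms(4), of ?m] by (simp add: mult.assoc)
  finally have "?m = 0" by simp
  moreover have "norm (y p) \<le> ?m" using s(2)[of 1] by simp
  ultimately show ?thesis by simp
qed

section \<open>Picard iteration\<close>

text \<open>A contraction principle that keeps the admissible class \<open>Q\<close> apart from the
  set \<open>C\<close> on which errors are measured. As \<open>U\<close> is a pointwise limit that
  does not mention \<open>C\<close>, the limits obtained for different \<open>C\<close> are one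
  function. \<open>Q U\<close> is a premise of the second part because limits need not inherit
  \<open>Q\<close>.\<close>

lemma picard_uniform_limit:
  fixes \<Phi> :: "('p \<Rightarrow> 'e::banach) \<Rightarrow> 'p \<Rightarrow> 'e"
  assumes "Q u0" "\<And>u. Q u \<Longrightarrow> Q (\<Phi> u)"
    and contr: "\<And>u v m. Q u \<Longrightarrow> Q v \<Longrightarrow> 0 \<le> m \<Longrightarrow> (\<And>p. p \<in> C \<Longrightarrow> norm (u p - v p) \<le> m) \<Longrightarrow>
        (\<And>p. p \<in> C \<Longrightarrow> norm (\<Phi> u p - \<Phi> v p) \<le> m / 2)"
    and "\<And>p. p \<in> C \<Longrightarrow> norm (\<Phi> u0 p - u0 p) \<le> M"
  defines "U \<equiv> \<lambda>p. lim (\<lambda>n. (\<Phi> ^^ n) u0 p)"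
  shows "uniform_limit C (\<lambda>n. (\<Phi> ^^ n) u0) U sequentially"
    and "Q U \<Longrightarrow> p \<in> C \<Longrightarrow> \<Phi> U p = U p"
proof -
  define f where "f n = (\<Phi> ^^ n) u0" for n
  have Q: "Q (f n)" for n
    by (induction n) (simp_all add: f_def assms(1,2))
  \<comment> \<open>\<open>contr\<close> asks for a nonnegative bound, and the absolute value
    provides one without inspecting \<open>C\<close>.\<close>
  have step: "norm (f (Suc n) p - f n p) \<le> \<bar>M\<bar> * (1/2) ^ n" if "p \<in> C" for n p
    using that
  proof (induction n arbitrary: p)
    case 0
    then show ?case using assms(4)[OF 0] by (simp add: f_def)
  next
    case (Suc n)
    have "norm (\<Phi> (f (Suc n)) p - \<Phi> (f n) p) \<le> \<bar>M\<bar> * (1/2) ^ n / 2"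
      by (rule contr[OF Q Q _ Suc.IH Suc.prems]) simp_all
    then show ?case by (simp add: f_def)
  qed
  have "uniformly_convergent_on C (\<lambda>n p. \<Sum>i<n. f (Suc i) p - f i p)"
    by (rule Weierstrass_m_test'[OF step]) (auto intro: summable_mult summable_geometric)
  then obtain l where "uniform_limit C (\<lambda>n p. \<Sum>i<n. f (Suc i) p - f i p) l sequentially"
    by (auto simp: uniformly_convergent_on_def)
  then have "uniform_limit C (\<lambda>n p. (\<Sum>i<n. f (Suc i) p - f i p) + u0 p) (\<lambda>p. l p + u0 p) sequentially"
    by (intro uniform_limit_intros)
  moreover have "(\<Sum>i<n. f (Suc i) p - f i p) + u0 p = f n p" for n p
    using sum_lessThan_telescope[of "\<lambda>i. f i p" n] by (simp add: f_def)
  ultimately have "uniformly_convergent_on C f"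
    by (auto simp: uniformly_convergent_on_def)
  then have lim: "uniform_limit C f U sequentially"
    by (simp add: uniformly_convergent_uniform_limit_iff U_def f_def)
  then show "uniform_limit C (\<lambda>n. (\<Phi> ^^ n) u0) U sequentially"
    by (simp add: f_def[abs_def])
  show "\<Phi> U p = U p" if "Q U" "p \<in> C"
  proof -
    have "(\<lambda>n. f (Suc n) p) \<longlonglongrightarrow> U p"
      using tendsto_uniform_limitI[OF lim \<open>p \<in> C\<close>] by (rule LIMSEQ_Suc)
    moreover have "(\<lambda>n. f (Suc n) p) \<longlonglongrightarrow> \<Phi> U p"
    proof (rule LIMSEQ_I)
      fix e :: real assume "0 < e"
      from uniform_limitD[OF lim this]
      obtain N where N: "\<And>n x. n \<ge> N \<Longrightarrow> x \<in> C \<Longrightarrow> norm (f n x - U x) \<le> e"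
        unfolding eventually_sequentially dist_norm by (metis less_imp_le)
      have "norm (\<Phi> (f n) p - \<Phi> U p) \<le> e / 2" if "n \<ge> N" for n
        by (rule contr[OF Q \<open>Q U\<close>]) (use N that \<open>0 < e\<close> \<open>p \<in> C\<close> in auto)
      then show "\<exists>no. \<forall>n\<ge>no. norm (f (Suc n) p - \<Phi> U p) < e"
        using \<open>0 < e\<close> by (intro exI[of _ N]) (force simp: f_def)
    qed
    ultimately show ?thesis using LIMSEQ_unique by blast
  qed
qed

text \<open>\<open>B\<close> may be unbounded near the boundary, so uniform convergence is shown on
  boxes \<open>cball 0 r \<times> D\<close> with \<open>D\<close> compact. Such a box contains the
  time path of each of its points, so the contraction estimate closes up on it, and the interiors of
  the boxes cover the domain. The unknown is operator-valued because it will serve as a difference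
  quotient.\<close>

lemma linear_kint_solution:
  fixes A :: "real \<times> 'z::euclidean_space \<Rightarrow> 'e::banach \<Rightarrow>\<^sub>L 'e"
    and B :: "real \<times> 'z \<Rightarrow> 'v::real_normed_vector \<Rightarrow>\<^sub>L 'e"
  assumes "open Z" "continuous_on (ball 0 d \<times> Z) A" "continuous_on (ball 0 d \<times> Z) B"
    and "\<And>p. p \<in> ball 0 d \<times> Z \<Longrightarrow> norm (A p) \<le> L" "d * L \<le> 1/2" "0 \<le> L"
  shows "\<exists>W. continuous_on (ball 0 d \<times> Z) W \<and>
    (\<forall>p\<in>ball 0 d \<times> Z. W p = B p + kint (\<lambda>q. A q o\<^sub>L W q) p)"
proof -
  let ?P = "ball (0::real) d \<times> Z"
  let ?\<Phi> = "\<lambda>u p. B p + kint (\<lambda>q. A q o\<^sub>L u q) p"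
  define W where "W p = lim (\<lambda>n. (?\<Phi> ^^ n) B p)" for p
  have Q: "continuous_on ?P (\<lambda>q. A q o\<^sub>L u q)" if "continuous_on ?P u" for u :: "real \<times> 'z \<Rightarrow> 'v \<Rightarrow>\<^sub>L 'e"
    using assms(2) that by (intro bounded_bilinear.continuous_on[OF bounded_bilinear_blinfun_compose])
  have Q\<Phi>: "continuous_on ?P (?\<Phi> u)" if "continuous_on ?P u" for u :: "real \<times> 'z \<Rightarrow> 'v \<Rightarrow>\<^sub>L 'e"
    by (intro continuous_on_add assms(3) kint_continuous Q that)
  have Qn: "continuous_on ?P ((?\<Phi> ^^ n) B)" for n
  proof (induction n)
    case (Suc n)
    then show ?case unfolding funpow.simps comp_apply by (rule Q\<Phi>)
  qed (simp add: assms(3))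
  have lim: "uniform_limit (cball 0 r \<times> D) (\<lambda>n. (?\<Phi> ^^ n) B) W sequentially \<and>
      (continuous_on ?P W \<longrightarrow> (\<forall>p\<in>cball 0 r \<times> D. ?\<Phi> W p = W p))"
    if "0 \<le> r" "r < d" "compact D" "D \<subseteq> Z" for r D
  proof -
    let ?C = "cball (0::real) r \<times> D"
    have CP: "?C \<subseteq> ?P" using \<open>r < d\<close> \<open>D \<subseteq> Z\<close> by (intro Sigma_mono) auto
    have "continuous_on ?C (\<lambda>p. ?\<Phi> B p - B p)"
      using continuous_on_subset[OF continuous_on_diff[OF Q\<Phi>[OF assms(3)] assms(3)] CP] .
    then have "compact ((\<lambda>p. ?\<Phi> B p - B p) ` ?C)"
      using that by (intro compact_continuous_image compact_Times compact_cball)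
    then have "bounded ((\<lambda>p. ?\<Phi> B p - B p) ` ?C)" by (rule compact_imp_bounded)
    then obtain M where "\<forall>x\<in>(\<lambda>p. ?\<Phi> B p - B p) ` ?C. norm x \<le> M"
      unfolding bounded_iff by (elim exE)
    then have M: "norm (?\<Phi> B p - B p) \<le> M" if "p \<in> ?C" for p
      using imageI[OF that] by (elim bspec)
    have contr: "norm (?\<Phi> u p - ?\<Phi> v p) \<le> m / 2"
      if u: "continuous_on ?P u" and v: "continuous_on ?P v" and m: "0 \<le> m"
        and le: "\<And>p. p \<in> ?C \<Longrightarrow> norm (u p - v p) \<le> m" and p: "p \<in> ?C"
      for u v :: "real \<times> 'z \<Rightarrow> 'v \<Rightarrow>\<^sub>L 'e" and m p
    proof -
      have pP: "p \<in> ?P" using p CP by blast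
      have "?\<Phi> u p - ?\<Phi> v p = kint (\<lambda>q. A q o\<^sub>L u q) p - kint (\<lambda>q. A q o\<^sub>L v q) p" by simp
      also have "\<dots> = kint (\<lambda>q. (A q o\<^sub>L u q) - (A q o\<^sub>L v q)) p"
        using kint_diff[OF Q[OF u] Q[OF v] pP] by simp
      also have "norm \<dots> \<le> \<bar>fst p\<bar> * (L * m)"
      proof (rule norm_kint_le[OF continuous_on_diff[OF Q[OF u] Q[OF v]] pP])
        fix s :: real assume s: "s \<in> {0..1}"
        let ?q = "(s * fst p, snd p)"
        have "\<bar>s * fst p\<bar> \<le> \<bar>fst p\<bar>"
          using s by (simp add: abs_mult mult_left_le_one_le)
        then have q: "?q \<in> ?C" using p by (auto simp: dist_norm)
        have "norm ((A ?q o\<^sub>L u ?q) - (A ?q o\<^sub>L v ?q)) = norm (A ?q o\<^sub>L (u ?q - v ?q))"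
          by (simp add: bounded_bilinear.diff_right[OF bounded_bilinear_blinfun_compose])
        also have "\<dots> \<le> norm (A ?q) * norm (u ?q - v ?q)"
          by (rule norm_blinfun_compose)
        also have "\<dots> \<le> L * m"
          using le[OF q] assms(4)[OF path_mem[OF pP s]] assms(6) by (intro mult_mono) simp_all
        finally show "norm ((A ?q o\<^sub>L u ?q) - (A ?q o\<^sub>L v ?q)) \<le> L * m" .
      qed
      also have "\<dots> \<le> d * (L * m)"
        using pP assms(6) m by (intro mult_right_mono) (auto simp: dist_norm)
      also have "\<dots> \<le> 1/2 * m"
        using mult_right_mono[OF assms(5) m] by (simp add: mult.assoc)
      finally show ?thesis by simp
    qed
    note pic = picard_uniform_limit[of "continuous_on ?P" B ?\<Phi> ?C M, OF assms(3) Q\<Phi> contr M]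
    have W: "W = (\<lambda>p. lim (\<lambda>n. (?\<Phi> ^^ n) B p))" by (rule ext) (rule W_def)
    show ?thesis
      unfolding W by (intro conjI impI ballI pic)
  qed
  have nbhd: "\<exists>r D. 0 \<le> r \<and> r < d \<and> compact D \<and> D \<subseteq> Z \<and> p \<in> interior (cball 0 r \<times> D)"
    if p: "p \<in> ?P" for p
  proof -
    obtain r where r: "\<bar>fst p\<bar> < r" "r < d" using p dense[of "\<bar>fst p\<bar>" d] by (auto simp: dist_norm)
    obtain e where e: "0 < e" "cball (snd p) e \<subseteq> Z"
      using p assms(1) by (auto simp: mem_Times_iff open_contains_cball)
    have "p \<in> interior (cball 0 r \<times> cball (snd p) e)"
      unfolding interior_Times using r e by (simp add: mem_Times_iff dist_norm)
    with r e show ?thesis by (intro exI[of _ r] exI[of _ "cball (snd p) e"]) auto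
  qed
  have contW: "continuous_on ?P W"
  proof (rule continuous_at_imp_continuous_on, rule ballI)
    fix p assume "p \<in> ?P"
    from nbhd[OF this] obtain r D where rD: "0 \<le> r" "r < d" "compact D" "D \<subseteq> Z"
      "p \<in> interior (cball 0 r \<times> D)" by auto
    have "cball 0 r \<times> D \<subseteq> ?P" using rD by (auto simp: dist_norm)
    then have "continuous_on (cball 0 r \<times> D) W"
      using lim[OF rD(1-4)] continuous_on_subset[OF Qn]
      by (intro uniform_limit_theorem[of _ "\<lambda>n. (?\<Phi> ^^ n) B" sequentially]) auto
    then show "isCont W p" using rD(5) continuous_on_interior by blast
  qed
  have "W p = B p + kint (\<lambda>q. A q o\<^sub>L W q) p" if p: "p \<in> ?P" for p
  proof -
    from nbhd[OF p] obtain r D where rD: "0 \<le> r" "r < d" "compact D" "D \<subseteq> Z"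
      "p \<in> interior (cball 0 r \<times> D)" by auto
    have p: "p \<in> cball 0 r \<times> D" by (rule subsetD[OF interior_subset rD(5)])
    show ?thesis
      by (rule sym) (rule bspec[OF mp[OF conjunct2[OF lim[OF rD(1-4)]] contW] p])
  qed
  with contW show ?thesis by (intro exI[of _ W]) simp
qed


section \<open>Differentiability of solutions\<close>

text \<open>Caratheodory's criterion: the remainder at \<open>y\<close> is
  \<open>(V y - V z) (y - z)\<close>, and its operator factor tends to 0.\<close>

lemma blinfun_quotient_has_derivative:
  fixes f :: "'a::real_normed_vector \<Rightarrow> 'b::real_normed_vector"
  assumes "open N" "z \<in> N" "\<And>y. y \<in> N \<Longrightarrow> f y - f z = blinfun_apply (V y) (y - z)" "isCont V z"
  shows "(f has_derivative V z) (at z)"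
proof -
  have "((\<lambda>y. (f y - f z - V z (y - z)) /\<^sub>R norm (y - z)) \<longlongrightarrow> 0) (at z)"
  proof (rule Lim_null_comparison)
    show "((\<lambda>y. norm (V y - V z)) \<longlongrightarrow> 0) (at z)"
      using assms(4) by (simp add: isCont_def LIM_zero tendsto_norm_zero)
    have "norm ((f y - f z - V z (y - z)) /\<^sub>R norm (y - z)) \<le> norm (V y - V z)" if "y \<in> N" for y
    proof -
      have "f y - f z - V z (y - z) = (V y - V z) (y - z)"
        using assms(3)[OF that] by (simp add: blinfun.diff_left)
      then show ?thesis
        using norm_blinfun[of "V y - V z" "y - z"]
        by (cases "y = z") (simp_all add: divide_inverse_commute[symmetric] divide_le_eq)
    qed
    then show "\<forall>\<^sub>F y in at z. norm ((f y - f z - V z (y - z)) /\<^sub>R norm (y - z)) \<le> norm (V y - V z)"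
      using assms(1,2) by (auto simp: eventually_at_topological)
  qed
  then show ?thesis
    by (simp add: has_derivative_at2 blinfun.bounded_linear_right diff_diff_eq inverse_eq_divide)
qed

text \<open>The factor of Hadamard's lemma: the mean of the derivative over the segment. It acts as
  a difference quotient that is jointly continuous in both end points, including the
  diagonal.\<close>

definition hadamard :: "('a::real_normed_vector \<Rightarrow> 'a \<Rightarrow>\<^sub>L 'b::banach) \<Rightarrow> 'a \<Rightarrow> 'a \<Rightarrow> 'a \<Rightarrow>\<^sub>L 'b" where
  "hadamard g' x y = integral {0..1} (\<lambda>s. g' (x + s *\<^sub>R (y - x)))"

lemma segment_mem:
  assumes "convex S" "x \<in> S" "y \<in> S" "s \<in> {0..1::real}"
  shows "x + s *\<^sub>R (y - x) \<in> S"
proof -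
  have "(1 - s) *\<^sub>R x + s *\<^sub>R y \<in> S"
    using assms by (intro convexD) auto
  then show ?thesis by (simp add: algebra_simps)
qed

lemma hadamard_continuous:
  assumes "convex S" "continuous_on S g'"
  shows "continuous_on (S \<times> S) (\<lambda>p. hadamard g' (fst p) (snd p))"
proof -
  have "continuous_on ((S \<times> S) \<times> cbox 0 1) (\<lambda>(p, s). g' (fst p + s *\<^sub>R (snd p - fst p)))"
    unfolding split_beta using segment_mem[OF assms(1)]
    by (intro continuous_on_compose2[OF assms(2)] continuous_intros) auto
  from integral_continuous_on_param[OF this] show ?thesis
    by (simp add: hadamard_def)
qed

lemma hadamard_path_continuous:
  fixes g' :: "'a::real_normed_vector \<Rightarrow> 'b::topological_space"
  assumes "convex S" "continuous_on S g'" "x \<in> S" "y \<in> S"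
  shows "continuous_on {0..1} (\<lambda>s. g' (x + s *\<^sub>R (y - x)))"
proof (rule continuous_on_compose2[OF assms(2)])
  show "continuous_on {0..1} (\<lambda>s. x + s *\<^sub>R (y - x))"
    by (intro continuous_intros)
qed (use segment_mem[OF assms(1,3,4)] in blast)

lemma hadamard_diff:
  fixes g :: "'a::real_normed_vector \<Rightarrow> 'b::banach"
  assumes "convex S" "continuous_on S g'" "x \<in> S" "y \<in> S"
    and "\<And>x. x \<in> S \<Longrightarrow> (g has_derivative blinfun_apply (g' x)) (at x)"
  shows "g y - g x = hadamard g' x y (y - x)"
proof -
  have "((\<lambda>s. g' (x + s *\<^sub>R (y - x)) (y - x)) has_integral
      g (x + 1 *\<^sub>R (y - x)) - g (x + 0 *\<^sub>R (y - x))) {0..1}"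
  proof (rule fundamental_theorem_of_calculus)
    fix s :: real assume s: "s \<in> {0..1}"
    have "((\<lambda>s. x + s *\<^sub>R (y - x)) has_derivative (\<lambda>h. h *\<^sub>R (y - x))) (at s)"
      by (auto intro!: derivative_eq_intros)
    from has_derivative_compose[OF this assms(5)[OF segment_mem[OF assms(1,3,4) s]]]
    have "((\<lambda>s. g (x + s *\<^sub>R (y - x))) has_vector_derivative g' (x + s *\<^sub>R (y - x)) (y - x)) (at s)"
      by (simp add: has_vector_derivative_def blinfun.scaleR_right)
    then show "((\<lambda>s. g (x + s *\<^sub>R (y - x))) has_vector_derivative g' (x + s *\<^sub>R (y - x)) (y - x))
        (at s within {0..1})"
      by (rule has_vector_derivative_at_within)
  qed simp
  then have "g y - g x = integral {0..1} (\<lambda>s. g' (x + s *\<^sub>R (y - x)) (y - x))"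
    by (simp add: integral_unique)
  also have "\<dots> = hadamard g' x y (y - x)"
    using integral_linear[OF integrable_continuous_real[OF hadamard_path_continuous[OF assms(1-4)]],
        of "\<lambda>h. h (y - x)"]
    by (simp add: hadamard_def o_def blinfun.bounded_linear_left)
  finally show ?thesis .
qed

lemma hadamard_same: "hadamard g' x x = g' x"
  by (simp add: hadamard_def)

lemma norm_hadamard_le:
  assumes "convex S" "continuous_on S g'" "x \<in> S" "y \<in> S" "\<And>x. x \<in> S \<Longrightarrow> norm (g' x) \<le> L"
  shows "norm (hadamard g' x y) \<le> L"
  using integral_bound[OF _ hadamard_path_continuous[OF assms(1-4)], of L]
    assms(5)[OF segment_mem[OF assms(1,3,4)]]
  by (simp add: hadamard_def)

text \<open>The difference quotient \<open>V\<close> of \<open>w\<close> in the space variable itself solves a linear integral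
  equation with coefficients depending continuously on both end points; so it extends continuously
  to the diagonal, which is differentiability.\<close>

lemma kint_space_derivative:
  fixes w :: "real \<times> 'z::euclidean_space \<Rightarrow> 'e::banach"
    and A :: "real \<times> ('z \<times> 'z) \<Rightarrow> 'e \<Rightarrow>\<^sub>L 'e" and B :: "real \<times> ('z \<times> 'z) \<Rightarrow> 'z \<Rightarrow>\<^sub>L 'e"
  assumes "open Z" and w: "continuous_on (ball 0 d \<times> Z) w"
    and A: "continuous_on (ball 0 d \<times> (Z \<times> Z)) A" and B: "continuous_on (ball 0 d \<times> (Z \<times> Z)) B"
    and L: "\<And>p. p \<in> ball 0 d \<times> (Z \<times> Z) \<Longrightarrow> norm (A p) \<le> L" "d * L \<le> 1/2" "0 \<le> L"
    and eq: "\<And>p. p \<in> ball 0 d \<times> (Z \<times> Z) \<Longrightarrow>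
      w (fst p, snd (snd p)) - w (fst p, fst (snd p)) = B p (snd (snd p) - fst (snd p)) +
        kint (\<lambda>q. A q (w (fst q, snd (snd q)) - w (fst q, fst (snd q)))) p"
  shows "\<exists>W. continuous_on (ball 0 d \<times> Z) W \<and> (\<forall>p\<in>ball 0 d \<times> Z.
    ((\<lambda>y. w (fst p, y)) has_derivative blinfun_apply (W p)) (at (snd p)) \<and>
    W p = B (fst p, snd p, snd p) + kint (\<lambda>q. A (fst q, snd q, snd q) o\<^sub>L W q) p)"
proof -
  let ?P = "ball (0::real) d \<times> Z" and ?P2 = "ball (0::real) d \<times> (Z \<times> Z)"
  have open2: "open (Z \<times> Z)" using assms(1) by (rule open_Times[OF _ assms(1)])
  obtain V where VV: "continuous_on ?P2 V \<and> (\<forall>p\<in>?P2. V p = B p + kint (\<lambda>q. A q o\<^sub>L V q) p)"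
    using linear_kint_solution[OF open2 A B L] by (rule exE)
  note V = conjunct1[OF VV] and Veq = bspec[OF conjunct2[OF VV]]
  let ?D = "\<lambda>q. w (fst q, snd (snd q)) - w (fst q, fst (snd q))"
  let ?h = "\<lambda>q :: real \<times> ('z \<times> 'z). snd (snd q) - fst (snd q)"
  have D: "continuous_on ?P2 ?D"
    by (intro continuous_on_diff continuous_on_compose2[OF w] continuous_intros) auto
  have Vh: "continuous_on ?P2 (\<lambda>q. V q (?h q))"
    by (intro continuous_intros V)
  have quot: "?D p = V p (?h p)" if p: "p \<in> ?P2" for p
  proof -
    \<comment> \<open>\<open>?D\<close> and \<open>V\<close> applied to \<open>?h\<close> solve the
      same linear equation with inhomogeneous term \<open>B p (?h p)\<close>, so their difference
      solves the homogeneous one.\<close>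
    have "?D p - V p (?h p) = 0"
    proof (rule kint_unique[OF continuous_on_diff[OF D Vh] A L _ p])
      fix p assume p: "p \<in> ?P2"
      have AV: "continuous_on ?P2 (\<lambda>q. A q o\<^sub>L V q)"
        by (intro bounded_bilinear.continuous_on[OF bounded_bilinear_blinfun_compose] A V)
      have "V p (?h p) = B p (?h p) + kint (\<lambda>q. A q o\<^sub>L V q) p (?h p)"
        by (subst Veq[OF p]) (simp add: blinfun.add_left)
      also have "kint (\<lambda>q. A q o\<^sub>L V q) p (?h p) = kint (\<lambda>q. A q (V q (?h q))) p"
        by (rule kint_linear[symmetric, OF blinfun.bounded_linear_left AV p]) simp
      finally have "?D p - V p (?h p) = kint (\<lambda>q. A q (?D q)) p - kint (\<lambda>q. A q (V q (?h q))) p"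
        using eq[OF p] by simp
      also have "\<dots> = kint (\<lambda>q. A q (?D q) - A q (V q (?h q))) p"
        by (intro kint_diff[symmetric, OF _ _ p] blinfun.continuous_on A D Vh)
      finally show "?D p - V p (?h p) = kint (\<lambda>q. A q (?D q - V q (?h q))) p"
        by (simp add: blinfun.diff_right)
    qed
    then show ?thesis by simp
  qed
  define W where "W q = V (fst q, snd q, snd q)" for q
  show ?thesis
  proof (intro exI[of _ W] conjI ballI)
    show "continuous_on ?P W"
      unfolding W_def by (intro continuous_on_compose2[OF V] continuous_intros) auto
    fix p assume p: "p \<in> ?P"
    obtain t z where ptz: "p = (t, z)" by (cases p)
    note tz = p[unfolded ptz]
    have "continuous_on Z (\<lambda>y. V (t, z, y))"
      using tz by (intro continuous_on_compose2[OF V] continuous_intros) auto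
    then have "isCont (\<lambda>y. V (t, z, y)) z"
      using tz assms(1) by (simp add: continuous_on_eq_continuous_at)
    moreover have "w (t, y) - w (t, z) = V (t, z, y) (y - z)" if "y \<in> Z" for y
      using quot[of "(t, z, y)"] tz that by simp
    ultimately have "((\<lambda>y. w (t, y)) has_derivative V (t, z, z)) (at z)"
      using tz by (intro blinfun_quotient_has_derivative[where N = Z] assms(1)) simp_all
    then show "((\<lambda>y. w (fst p, y)) has_derivative W p) (at (snd p))"
      by (simp add: W_def ptz)
    have "W (t, z) = B (t, z, z) + kint (\<lambda>q. A q o\<^sub>L V q) (t, z, z)"
      unfolding W_def using Veq[of "(t, z, z)"] tz by simp
    also have "kint (\<lambda>q. A q o\<^sub>L V q) (t, z, z) =
        kint (\<lambda>q. A (fst q, snd q, snd q) o\<^sub>L W q) (t, z)"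
      by (simp add: kint_def W_def)
    finally show "W p = B (fst p, snd p, snd p) + kint (\<lambda>q. A (fst q, snd q, snd q) o\<^sub>L W q) p"
      by (simp add: ptz)
  qed
qed

text \<open>One partial derivative at the point and a continuous partial derivative in the other
  variable give the total derivative. Integral equations deliver just this: the time derivative is
  read off the integrand, and \<open>W\<close> is continuous by construction.\<close>

lemma has_derivative_time_space:
  fixes f :: "real \<times> 'z::euclidean_space \<Rightarrow> 'e::real_normed_vector"
  assumes "open Z" "convex Z" "continuous_on (ball 0 d \<times> Z) W"
    and "\<And>p. p \<in> ball 0 d \<times> Z \<Longrightarrow>
      ((\<lambda>y. f (fst p, y)) has_derivative blinfun_apply (W p)) (at (snd p))"
    and "((\<lambda>t. f (t, z)) has_vector_derivative f') (at t)" "(t, z) \<in> ball 0 d \<times> Z"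
  shows "(f has_derivative (\<lambda>v. fst v *\<^sub>R f' + W (t, z) (snd v))) (at (t, z))"
proof -
  have op: "open (ball (0::real) d \<times> Z)" using assms(1) by (intro open_Times) auto
  have "((\<lambda>(x, y). f (x, y)) has_derivative (\<lambda>(tx, ty). tx *\<^sub>R f' + W (t, z) ty))
      (at (t, z) within ball 0 d \<times> Z)"
  proof (rule has_derivative_partialsI[where fx = "\<lambda>tx. tx *\<^sub>R f'" and fy = "\<lambda>x y. W (x, y)"])
    show "((\<lambda>x. f (x, z)) has_derivative (\<lambda>tx. tx *\<^sub>R f')) (at t within ball 0 d)"
      using assms(5) by (auto simp: has_vector_derivative_def intro: has_derivative_at_withinI)
    show "((\<lambda>y. f (x, y)) has_derivative W (x, y)) (at y within Z)" if "x \<in> ball 0 d" "y \<in> Z" for x y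
      using assms(4)[of "(x, y)"] that by (auto intro: has_derivative_at_withinI)
    show "continuous (at (t, z) within ball 0 d \<times> Z) (\<lambda>(x, y). W (x, y))"
      using assms(3,6) by (simp add: continuous_on_eq_continuous_within)
  qed (use assms in auto)
  then show ?thesis
    using assms(6) by (simp add: at_within_open[OF _ op] case_prod_unfold)
qed


section \<open>Regularity of solutions and the flow of a vector field\<close>

definition inr_blinfun :: "'b::real_normed_vector \<Rightarrow>\<^sub>L ('a::real_normed_vector \<times> 'b)" where
  "inr_blinfun = Blinfun (Pair 0)"

lemma inr_blinfun_apply [simp]: "blinfun_apply inr_blinfun v = (0, v)"
  unfolding inr_blinfun_def
  by (subst bounded_linear_Blinfun_apply)
    (auto intro: bounded_linear_Pair bounded_linear_zero bounded_linear_ident)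

lemma has_derivative_space_slice:
  assumes "(f has_derivative blinfun_apply T) (at (t, z))"
  shows "((\<lambda>y. f (t, y)) has_derivative blinfun_apply (T o\<^sub>L inr_blinfun)) (at z)"
proof -
  have "((\<lambda>y. (t, y)) has_derivative (\<lambda>v. (0, v))) (at z)"
    by (auto intro!: derivative_eq_intros)
  from has_derivative_compose[OF this assms] show ?thesis
    by (simp add: blinfun_compose.rep_eq o_def)
qed

lemma has_derivative_time_slice:
  fixes f :: "real \<times> 'b::real_normed_vector \<Rightarrow> 'c::real_normed_vector"
  assumes "(f has_derivative blinfun_apply T) (at (t, z))"
  shows "((\<lambda>t. f (t, z)) has_vector_derivative T (1, 0)) (at t)"
proof -
  have "((\<lambda>t. (t, z)) has_derivative (\<lambda>v. (v, 0))) (at t)"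
    by (auto intro!: derivative_eq_intros)
  from has_derivative_compose[OF this assms]
  have "((\<lambda>t. f (t, z)) has_derivative (\<lambda>v. T (v *\<^sub>R (1, 0)))) (at t)" by simp
  then show ?thesis by (simp only: has_vector_derivative_def blinfun.scaleR_right)
qed

text \<open>Time differentiation undoes \<open>kint\<close> and space differentiation passes under
  the integral. So the derivative of \<open>kint g\<close> is made of \<open>g\<close> and of
  \<open>kint\<close> of a derivative of \<open>g\<close>, both of class \<open>k\<close>.\<close>

lemma kint_Ck:
  fixes g :: "real \<times> 'z::euclidean_space \<Rightarrow> 'e::banach"
  assumes "open Z" "convex Z" "Ck_on k g (ball 0 d \<times> Z)"
  shows "Ck_on k (kint g) (ball 0 d \<times> Z)"
  using assms(3)
proof (induction k arbitrary: g)
  case 0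
  then show ?case by (simp add: kint_continuous)
next
  case (Suc k)
  let ?P = "ball (0::real) d \<times> Z"
  have op: "open ?P" using assms(1) by (intro open_Times) auto
  have g': "(g has_derivative fderiv g p) (at p)" if "p \<in> ?P" for p
    using fderiv_has_derivative[OF Suc.prems that] .
  have g'c: "continuous_on ?P (fderiv g)"
    using Ck_on_continuous[OF Ck_on_fderiv[OF op Suc.prems]] .
  define W where "W = kint (\<lambda>q. fderiv g q o\<^sub>L inr_blinfun)"
  have Wc0: "continuous_on ?P (\<lambda>q. fderiv g q o\<^sub>L inr_blinfun)"
    by (intro bounded_bilinear.continuous_on[OF bounded_bilinear_blinfun_compose] g'c continuous_on_const)
  have Wc: "continuous_on ?P W"
    unfolding W_def by (rule kint_continuous[OF Wc0])
  have z: "((\<lambda>y. kint g (fst p, y)) has_derivative W p) (at (snd p))" if p: "p \<in> ?P" for p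
  proof -
    obtain t z where ptz: "p = (t, z)" by (cases p)
    note tz = p[unfolded ptz]
    have mem: "(s * t, y) \<in> ?P" if "y \<in> Z" "s \<in> {0..1}" for s y
      using path_mem[of "(t, y)" d Z s] tz that by simp
    have "((\<lambda>y. integral (cbox 0 1) (\<lambda>s. g (s * t, y))) has_derivative
        integral (cbox 0 1) (\<lambda>s. fderiv g (s * t, z) o\<^sub>L inr_blinfun)) (at z within Z)"
    proof (rule leibniz_rule)
      show "((\<lambda>y. g (s * t, y)) has_derivative (fderiv g (s * t, y) o\<^sub>L inr_blinfun)) (at y within Z)"
        if "y \<in> Z" "s \<in> cbox 0 1" for y s
        using has_derivative_space_slice[OF g'[OF mem]] that
        by (auto intro: has_derivative_at_withinI)
      show "(\<lambda>s. g (s * t, y)) integrable_on cbox 0 1" if "y \<in> Z" for y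
        using integrable_continuous_real[OF continuous_on_path[OF Ck_on_continuous[OF Suc.prems], of "(t, y)"]]
          that tz by simp
      show "continuous_on (Z \<times> cbox 0 1) (\<lambda>(y, s). fderiv g (s * t, y) o\<^sub>L inr_blinfun)"
        unfolding split_beta
        by (intro continuous_on_compose2[OF Wc0] continuous_intros) (use mem in auto)
    qed (use tz assms in auto)
    moreover have "at z within Z = at z" using tz assms(1) by (intro at_within_open) auto
    ultimately have "((\<lambda>y. integral {0..1} (\<lambda>s. g (s * t, y))) has_derivative
        integral {0..1} (\<lambda>s. fderiv g (s * t, z) o\<^sub>L inr_blinfun)) (at z)"
      by simp
    from has_derivative_scaleR_right[OF this, of t] show ?thesis
      by (simp add: kint_def W_def ptz scaleR_blinfun.rep_eq)
  qed
  show ?case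
  proof (rule Ck_on_SucI[OF op])
    fix p assume "p \<in> ?P"
    then show "(kint g has_derivative (\<lambda>v. fst v *\<^sub>R g p + W p (snd v))) (at p)"
      using has_derivative_time_space[OF assms(1,2) Wc z
          kint_has_time_derivative[OF Ck_on_continuous[OF Suc.prems]], of "fst p" "snd p"] by simp
  next
    fix v :: "real \<times> 'z"
    \<comment> \<open>The induction hypothesis concerns functions with values in the type of
      \<open>g\<close>, so the operator-valued integrand is first evaluated at a fixed
      direction.\<close>
    have "Ck_on k (\<lambda>q. fderiv g q (0, snd v)) ?P"
      by (intro Ck_on_bilinear[OF bounded_bilinear_blinfun_apply op] Ck_on_fderiv Suc.prems op Ck_on_const)
    then have "Ck_on k (kint (\<lambda>q. fderiv g q (0, snd v))) ?P" by (rule Suc.IH)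
    moreover have "kint (\<lambda>q. fderiv g q (0, snd v)) p = W p (snd v)" if "p \<in> ?P" for p
      unfolding W_def by (rule kint_linear[OF blinfun.bounded_linear_left Wc0 that]) simp
    ultimately have "Ck_on k (\<lambda>p. W p (snd v)) ?P" by (rule Ck_on_cong_imp[OF op])
    then show "Ck_on k (\<lambda>p. fst v *\<^sub>R g p + W p (snd v)) ?P"
      by (intro Ck_on_add Ck_on_scaleR op Ck_on_const Ck_on_SucD[OF Suc.prems])
  qed
qed

text \<open>The induction hypothesis is used twice. It first makes \<open>w\<close> of class
  \<open>k\<close>. Differentiating the equation in space along \<open>v\<close> gives an equation
  for \<open>W p v\<close> with the same \<open>A\<close>, whose inhomogeneous term contains
  derivatives of \<open>A\<close> and \<open>b\<close> and \<open>w\<close> itself, hence is of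
  class \<open>k\<close> by the first use. The second use then makes \<open>W p v\<close> of class
  \<open>k\<close>.\<close>

lemma linear_kint_Ck:
  fixes A :: "real \<times> 'z::euclidean_space \<Rightarrow> 'e::banach \<Rightarrow>\<^sub>L 'e"
  assumes "open Z" "convex Z" "Ck_on k A (ball 0 d \<times> Z)" "Ck_on k b (ball 0 d \<times> Z)"
    and "continuous_on (ball 0 d \<times> Z) w"
    and L: "\<And>p. p \<in> ball 0 d \<times> Z \<Longrightarrow> norm (A p) \<le> L" "d * L \<le> 1/2" "0 \<le> L"
    and "\<And>p. p \<in> ball 0 d \<times> Z \<Longrightarrow> w p = b p + kint (\<lambda>q. A q (w q)) p"
  shows "Ck_on k w (ball 0 d \<times> Z)"
  using assms(3-5,9)
proof (induction k arbitrary: b w)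
  case 0
  then show ?case by simp
next
  case (Suc k)
  let ?P = "ball (0::real) d \<times> Z" and ?P2 = "ball (0::real) d \<times> (Z \<times> Z)"
  note ACk = Suc.prems(1) and bCk = Suc.prems(2) and wc = Suc.prems(3) and weq = Suc.prems(4)
  have op: "open ?P" using assms(1) by (intro open_Times) auto
  have cv: "convex ?P" using assms(2) by (intro convex_Times) auto
  note Ac = Ck_on_continuous[OF ACk]
  have wk: "Ck_on k w ?P"
    using Suc.IH[OF Ck_on_SucD[OF ACk] Ck_on_SucD[OF bCk] wc weq] .
  have A'c: "continuous_on ?P (fderiv A)" and b'c: "continuous_on ?P (fderiv b)"
    using Ck_on_continuous[OF Ck_on_fderiv[OF op]] ACk bCk by blast+
  let ?l = "\<lambda>q :: real \<times> ('z \<times> 'z). (fst q, fst (snd q))"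
  let ?r = "\<lambda>q :: real \<times> ('z \<times> 'z). (fst q, snd (snd q))"
  let ?h = "\<lambda>q :: real \<times> ('z \<times> 'z). snd (snd q) - fst (snd q)"
  have lr: "?l q \<in> ?P" "?r q \<in> ?P" if "q \<in> ?P2" for q using that by auto
  have lc: "continuous_on ?P2 ?l" and rc: "continuous_on ?P2 ?r"
    by (intro continuous_intros)+
  \<comment> \<open>The difference of \<open>A q (w q)\<close> at the two points is \<open>A (?r q)
    (w (?r q) - w (?l q)) + (A (?r q) - A (?l q)) (w (?l q))\<close>. By Hadamard's lemma the last
    summand is an operator applied to \<open>?h q\<close>, and \<open>C q\<close> is that operator.
    Both points have the same time, so the increment is purely spatial, hence
    \<open>inr_blinfun\<close>.\<close>
  define C where "C q = blinfun.prod_left (w (?l q)) o\<^sub>L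
    hadamard (fderiv A) (?l q) (?r q) o\<^sub>L inr_blinfun" for q
  define B where "B q = (hadamard (fderiv b) (?l q) (?r q) o\<^sub>L inr_blinfun) + kint C q" for q
  have hc: "continuous_on ?P2 (\<lambda>q. hadamard f' (?l q) (?r q))"
    if "continuous_on ?P f'" for f' :: "real \<times> 'z \<Rightarrow> (real \<times> 'z) \<Rightarrow>\<^sub>L 'f::banach"
  proof -
    have "continuous_on ?P2 (\<lambda>q. (?l q, ?r q))" by (intro continuous_intros)
    moreover have "(\<lambda>q. (?l q, ?r q)) ` ?P2 \<subseteq> ?P \<times> ?P" by auto
    ultimately show ?thesis
      using continuous_on_compose2[OF hadamard_continuous[OF cv that], of ?P2 "\<lambda>q. (?l q, ?r q)"]
      by (simp only: fst_conv snd_conv)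
  qed
  have wl: "continuous_on ?P2 (\<lambda>q. w (?l q))" and wr: "continuous_on ?P2 (\<lambda>q. w (?r q))"
    and Al: "continuous_on ?P2 (\<lambda>q. A (?l q))" and Ar: "continuous_on ?P2 (\<lambda>q. A (?r q))"
    using lr by (auto intro!: continuous_on_compose2[OF wc] continuous_on_compose2[OF Ac] lc rc)
  have Cc: "continuous_on ?P2 C"
    unfolding C_def
    by (intro bounded_bilinear.continuous_on[OF bounded_bilinear_blinfun_compose] continuous_on_const hc A'c
        bounded_linear.continuous_on[OF blinfun.bounded_linear_prod_left] wl)
  have Bc: "continuous_on ?P2 B"
    unfolding B_def
    by (intro continuous_on_add kint_continuous Cc
        bounded_bilinear.continuous_on[OF bounded_bilinear_blinfun_compose] continuous_on_const hc b'c)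
  have Dc: "continuous_on ?P2 (\<lambda>q. A (?r q) (w (?r q) - w (?l q)))"
    by (intro blinfun.continuous_on Ar continuous_on_diff wl wr)
  have Chc: "continuous_on ?P2 (\<lambda>q. C q (?h q))"
    by (intro blinfun.continuous_on Cc continuous_intros)
  have eq: "w (?r p) - w (?l p) = B p (?h p) + kint (\<lambda>q. A (?r q) (w (?r q) - w (?l q))) p"
    if p: "p \<in> ?P2" for p
  proof -
    have "kint (\<lambda>q. A q (w q)) (?r p) - kint (\<lambda>q. A q (w q)) (?l p) =
        kint (\<lambda>q. A (?r q) (w (?r q))) p - kint (\<lambda>q. A (?l q) (w (?l q))) p"
      by (simp add: kint_def)
    also have "\<dots> = kint (\<lambda>q. A (?r q) (w (?r q)) - A (?l q) (w (?l q))) p"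
      by (intro kint_diff[symmetric, OF _ _ p] blinfun.continuous_on Al Ar wl wr)
    also have "\<dots> = kint (\<lambda>q. A (?r q) (w (?r q) - w (?l q)) + C q (?h q)) p"
    proof (rule kint_cong)
      fix s :: real assume "s \<in> {0..1}"
      then have q: "(s * fst p, snd p) \<in> ?P2" (is "?q \<in> _") by (rule path_mem[OF p])
      have "A (?r ?q) - A (?l ?q) = hadamard (fderiv A) (?l ?q) (?r ?q) (?r ?q - ?l ?q)"
        using lr[OF q] fderiv_has_derivative[OF ACk]
        by (intro hadamard_diff[OF cv A'c]) auto
      then have "C ?q (?h ?q) = (A (?r ?q) - A (?l ?q)) (w (?l ?q))"
        by (simp add: C_def blinfun.prod_left.rep_eq)
      then show "A (?r ?q) (w (?r ?q)) - A (?l ?q) (w (?l ?q)) =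
          A (?r ?q) (w (?r ?q) - w (?l ?q)) + C ?q (?h ?q)"
        by (simp only: blinfun.diff_left blinfun.diff_right) simp
    qed
    also have "\<dots> = kint (\<lambda>q. A (?r q) (w (?r q) - w (?l q))) p + kint (\<lambda>q. C q (?h q)) p"
      by (rule kint_add[OF Dc Chc p])
    also have "kint (\<lambda>q. C q (?h q)) p = kint C p (?h p)"
      by (rule kint_linear[OF blinfun.bounded_linear_left Cc p]) simp
    finally have 1: "kint (\<lambda>q. A q (w q)) (?r p) - kint (\<lambda>q. A q (w q)) (?l p) =
        kint (\<lambda>q. A (?r q) (w (?r q) - w (?l q))) p + kint C p (?h p)" .
    have 2: "b (?r p) - b (?l p) = hadamard (fderiv b) (?l p) (?r p) (?r p - ?l p)"
      using lr[OF p] fderiv_has_derivative[OF bCk]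
      by (intro hadamard_diff[OF cv b'c]) auto
    have "w (?r p) - w (?l p) = (b (?r p) - b (?l p)) +
        (kint (\<lambda>q. A q (w q)) (?r p) - kint (\<lambda>q. A q (w q)) (?l p))"
      using weq[OF lr(1)[OF p]] weq[OF lr(2)[OF p]] by simp
    then show ?thesis
      unfolding 1 2 by (simp add: B_def blinfun.add_left)
  qed
  obtain W where WW: "continuous_on ?P W \<and> (\<forall>p\<in>?P.
      ((\<lambda>y. w (fst p, y)) has_derivative blinfun_apply (W p)) (at (snd p)) \<and>
      W p = B (fst p, snd p, snd p) + kint (\<lambda>q. A (?r (fst q, snd q, snd q)) o\<^sub>L W q) p)"
    using kint_space_derivative[OF assms(1) wc Ar Bc L(1)[OF lr(2)] L(2,3) eq]
    by (rule exE)
  note Wc = conjunct1[OF WW]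
    and Wd = conjunct1[OF bspec[OF conjunct2[OF WW]]]
    and Weq = conjunct2[OF bspec[OF conjunct2[OF WW]], unfolded fst_conv snd_conv prod.collapse]
  have WCk: "Ck_on k (\<lambda>p. W p v) ?P" for v
  proof -
    \<comment> \<open>The inhomogeneous term after differentiation along \<open>v\<close>: the
      derivative of \<open>b\<close>, and the part of the product rule for \<open>A q (w q)\<close>
      in which \<open>A\<close> is differentiated.\<close>
    define b1 where "b1 p = fderiv b p (0, v) + kint (\<lambda>q. fderiv A q (0, v) (w q)) p" for p
    have A1: "Ck_on k (\<lambda>q. fderiv A q (0, v) (w q)) ?P"
      by (intro Ck_on_bilinear[OF bounded_bilinear_blinfun_apply op] Ck_on_fderiv op ACk wk Ck_on_const)
    have b1Ck: "Ck_on k b1 ?P"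
      unfolding b1_def[abs_def]
      by (intro Ck_on_add[OF op] kint_Ck[OF assms(1,2) A1]
          Ck_on_bilinear[OF bounded_bilinear_blinfun_apply op] Ck_on_fderiv op bCk Ck_on_const)
    show ?thesis
    proof (rule Suc.IH[OF Ck_on_SucD[OF ACk] b1Ck])
      show "continuous_on ?P (\<lambda>p. W p v)" by (intro continuous_intros Wc)
      fix p assume p: "p \<in> ?P"
      let ?C1 = "\<lambda>q. blinfun.prod_left (w q) o\<^sub>L fderiv A q o\<^sub>L inr_blinfun"
      have C1: "continuous_on ?P ?C1"
        by (intro bounded_bilinear.continuous_on[OF bounded_bilinear_blinfun_compose] continuous_on_const A'c
            bounded_linear.continuous_on[OF blinfun.bounded_linear_prod_left] wc)
      have AW: "continuous_on ?P (\<lambda>q. A q o\<^sub>L W q)"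
        by (intro bounded_bilinear.continuous_on[OF bounded_bilinear_blinfun_compose] Ac Wc)
      have "kint C (fst p, snd p, snd p) = kint ?C1 p"
        by (simp add: kint_def C_def hadamard_same)
      then have "B (fst p, snd p, snd p) v = fderiv b p (0, v) + kint ?C1 p v"
        by (simp add: B_def hadamard_same blinfun.add_left)
      moreover have "kint ?C1 p v = kint (\<lambda>q. fderiv A q (0, v) (w q)) p"
        by (rule kint_linear[symmetric, OF blinfun.bounded_linear_left C1 p])
          (simp add: blinfun.prod_left.rep_eq)
      moreover have "kint (\<lambda>q. A q o\<^sub>L W q) p v = kint (\<lambda>q. A q (W q v)) p"
        by (rule kint_linear[symmetric, OF blinfun.bounded_linear_left AW p]) simp
      ultimately show "W p v = b1 p + kint (\<lambda>q. A q (W q v)) p"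
        using Weq[OF p] by (simp add: b1_def blinfun.add_left)
    qed
  qed
  have wt: "((\<lambda>t. w (t, z)) has_vector_derivative fderiv b (t, z) (1, 0) + A (t, z) (w (t, z))) (at t)"
    if tz: "(t, z) \<in> ?P" for t z
  proof -
    have "((\<lambda>t. b (t, z) + kint (\<lambda>q. A q (w q)) (t, z)) has_vector_derivative
        fderiv b (t, z) (1, 0) + A (t, z) (w (t, z))) (at t)"
      by (intro has_vector_derivative_add has_derivative_time_slice fderiv_has_derivative[OF bCk tz]
          kint_has_time_derivative[OF _ tz] blinfun.continuous_on Ac wc)
    then show ?thesis
    proof (rule has_vector_derivative_transform_within_open[where S = "ball 0 d"])
      show "b (s, z) + kint (\<lambda>q. A q (w q)) (s, z) = w (s, z)" if "s \<in> ball 0 d" for s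
        using weq[of "(s, z)"] that tz by simp
    qed (use tz in auto)
  qed
  show ?case
  proof (rule Ck_on_SucI[OF op])
    fix p assume "p \<in> ?P"
    then show "(w has_derivative (\<lambda>v. fst v *\<^sub>R (fderiv b p (1, 0) + A p (w p)) + W p (snd v))) (at p)"
      using has_derivative_time_space[OF assms(1,2) Wc Wd wt, of "fst p" "snd p"] by simp
  next
    fix v :: "real \<times> 'z"
    show "Ck_on k (\<lambda>p. fst v *\<^sub>R (fderiv b p (1, 0) + A p (w p)) + W p (snd v)) ?P"
      by (intro Ck_on_add Ck_on_scaleR op Ck_on_const WCk
          Ck_on_bilinear[OF bounded_bilinear_blinfun_apply op] Ck_on_fderiv bCk wk Ck_on_SucD[OF ACk])
  qed
qed


text \<open>Hadamard's factor turns the nonlinear difference \<open>F y - F x\<close> into an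
  operator applied to \<open>y - x\<close>, convexity of \<open>S\<close> keeping the segment
  inside. The space derivative \<open>W\<close> then solves the variational equation with
  coefficient \<open>fderiv F (u q)\<close>. The last conclusion expresses that the flow carries
  \<open>F\<close> to itself; it is what will make the first integrals constant along
  \<open>F\<close>.\<close>

lemma Ck_on_flow:
  fixes F :: "'e::euclidean_space \<Rightarrow> 'e"
  assumes Z: "open Z" "convex Z" and S: "open S" "convex S" and F: "smooth_on F S"
    and L: "\<And>x. x \<in> S \<Longrightarrow> norm (fderiv F x) \<le> L" "d * L \<le> 1/2" "0 \<le> L"
    and uc: "continuous_on (ball 0 d \<times> Z) u" and uS: "\<And>p. p \<in> ball 0 d \<times> Z \<Longrightarrow> u p \<in> S"
    and ueq: "\<And>p. p \<in> ball 0 d \<times> Z \<Longrightarrow> u p = snd p + kint (\<lambda>q. F (u q)) p"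
    and ZS: "Z \<subseteq> S"
  shows "smooth_on u (ball 0 d \<times> Z)"
    and "p \<in> ball 0 d \<times> Z \<Longrightarrow> fderiv u p (1, 0) = F (u p)"
    and "p \<in> ball 0 d \<times> Z \<Longrightarrow> fderiv u p (0, F (snd p)) = F (u p)"
proof -
  let ?P = "ball (0::real) d \<times> Z" and ?P2 = "ball (0::real) d \<times> (Z \<times> Z)"
  let ?l = "\<lambda>q :: real \<times> ('e \<times> 'e). (fst q, fst (snd q))"
  let ?r = "\<lambda>q :: real \<times> ('e \<times> 'e). (fst q, snd (snd q))"
  have op: "open ?P" using Z(1) by (intro open_Times) auto
  have FCk: "Ck_on k F S" for k using F by (simp add: smooth_on_def)
  have Fd: "(F has_derivative fderiv F x) (at x)" if "x \<in> S" for x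
    using fderiv_has_derivative[OF FCk that] .
  have F'c: "continuous_on S (fderiv F)"
    using Ck_on_continuous[OF Ck_on_fderiv[OF S(1) FCk]] .
  note Fc = Ck_on_continuous[OF FCk]
  have Fuc: "continuous_on ?P (\<lambda>q. F (u q))"
    using uS by (intro continuous_on_compose2[OF Fc uc]) auto
  have F'uc: "continuous_on ?P (\<lambda>q. fderiv F (u q))"
    using uS by (intro continuous_on_compose2[OF F'c uc]) auto
  have lr: "?l q \<in> ?P" "?r q \<in> ?P" if "q \<in> ?P2" for q using that by auto
  have ulc: "continuous_on ?P2 (\<lambda>q. u (?l q))" and urc: "continuous_on ?P2 (\<lambda>q. u (?r q))"
    by (intro continuous_on_compose2[OF uc] continuous_intros; use lr in blast)+
  define A where "A q = hadamard (fderiv F) (u (?l q)) (u (?r q))" for q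
  have Ac: "continuous_on ?P2 A"
  proof -
    have "continuous_on ?P2 (\<lambda>q. (u (?l q), u (?r q)))" by (intro continuous_on_Pair ulc urc)
    moreover have "(\<lambda>q. (u (?l q), u (?r q))) ` ?P2 \<subseteq> S \<times> S" using uS lr by blast
    ultimately show ?thesis
      using continuous_on_compose2[OF hadamard_continuous[OF S(2) F'c], of ?P2 "\<lambda>q. (u (?l q), u (?r q))"]
      unfolding A_def[abs_def] by (simp only: fst_conv snd_conv)
  qed
  have AL: "norm (A q) \<le> L" if "q \<in> ?P2" for q
    unfolding A_def using norm_hadamard_le[OF S(2) F'c uS[OF lr(1)] uS[OF lr(2)] L(1)] that by simp
  have eq: "u (?r p) - u (?l p) = id_blinfun (snd (snd p) - fst (snd p)) +
      kint (\<lambda>q. A q (u (?r q) - u (?l q))) p" if p: "p \<in> ?P2" for p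
  proof -
    have "continuous_on ?P2 (\<lambda>q. F (u (?r q)))" "continuous_on ?P2 (\<lambda>q. F (u (?l q)))"
      by (intro continuous_on_compose2[OF Fc] ulc urc; use uS lr in blast)+
    note Fdiff = kint_diff[OF this p]
    have "u (?r p) - u (?l p) = (snd (snd p) - fst (snd p)) +
        (kint (\<lambda>q. F (u q)) (?r p) - kint (\<lambda>q. F (u q)) (?l p))"
      using ueq[OF lr(1)[OF p]] ueq[OF lr(2)[OF p]] by simp
    also have "kint (\<lambda>q. F (u q)) (?r p) - kint (\<lambda>q. F (u q)) (?l p) =
        kint (\<lambda>q. F (u (?r q)) - F (u (?l q))) p"
      unfolding Fdiff by (simp add: kint_def)
    also have "\<dots> = kint (\<lambda>q. A q (u (?r q) - u (?l q))) p"
    proof (rule kint_cong)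
      fix s :: real assume "s \<in> {0..1}"
      then have q: "(s * fst p, snd p) \<in> ?P2" (is "?q \<in> _") by (rule path_mem[OF p])
      show "F (u (?r ?q)) - F (u (?l ?q)) = A ?q (u (?r ?q) - u (?l ?q))"
        unfolding A_def by (rule hadamard_diff[OF S(2) F'c uS[OF lr(1)[OF q]] uS[OF lr(2)[OF q]] Fd])
    qed
    finally show ?thesis by simp
  qed
  obtain W where WW: "continuous_on ?P W \<and> (\<forall>p\<in>?P.
      ((\<lambda>y. u (fst p, y)) has_derivative blinfun_apply (W p)) (at (snd p)) \<and>
      W p = id_blinfun + kint (\<lambda>q. A (fst q, snd q, snd q) o\<^sub>L W q) p)"
    using kint_space_derivative[OF Z(1) uc Ac continuous_on_const AL L(2,3) eq] by (rule exE)
  note Wc = conjunct1[OF WW]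
    and Wd = conjunct1[OF bspec[OF conjunct2[OF WW]]]
  have Weq0: "W p = id_blinfun + kint (\<lambda>q. fderiv F (u q) o\<^sub>L W q) p" if "p \<in> ?P" for p
    using conjunct2[OF bspec[OF conjunct2[OF WW] that]]
    by (simp add: A_def hadamard_same)
  have AW: "continuous_on ?P (\<lambda>q. fderiv F (u q) o\<^sub>L W q)"
    by (intro bounded_bilinear.continuous_on[OF bounded_bilinear_blinfun_compose] F'uc Wc)
  have Wv: "W p v = v + kint (\<lambda>q. fderiv F (u q) (W q v)) p" if p: "p \<in> ?P" for p v
  proof -
    have "kint (\<lambda>q. fderiv F (u q) o\<^sub>L W q) p v = kint (\<lambda>q. fderiv F (u q) (W q v)) p"
      by (rule kint_linear[symmetric, OF blinfun.bounded_linear_left AW p]) simp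
    then show ?thesis by (subst Weq0[OF p]) (simp add: blinfun.add_left)
  qed
  have ut: "((\<lambda>t. u (t, z)) has_vector_derivative F (u (t, z))) (at t)"
    if tz: "(t, z) \<in> ?P" for t z
  proof -
    have "((\<lambda>t. snd (t, z) + kint (\<lambda>q. F (u q)) (t, z)) has_vector_derivative 0 + F (u (t, z))) (at t)"
      unfolding snd_conv
      by (intro has_vector_derivative_add has_vector_derivative_const kint_has_time_derivative[OF Fuc tz])
    then have "((\<lambda>t. snd (t, z) + kint (\<lambda>q. F (u q)) (t, z)) has_vector_derivative F (u (t, z))) (at t)"
      by (simp only: add_0)
    then show ?thesis
    proof (rule has_vector_derivative_transform_within_open[where S = "ball 0 d"])
      show "snd (s, z) + kint (\<lambda>q. F (u q)) (s, z) = u (s, z)" if "s \<in> ball 0 d" for s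
        using ueq[of "(s, z)"] that tz by simp
    qed (use tz in auto)
  qed
  have ud: "(u has_derivative (\<lambda>v. fst v *\<^sub>R F (u p) + W p (snd v))) (at p)" if "p \<in> ?P" for p
    using has_derivative_time_space[OF Z Wc Wd ut, of "fst p" "snd p"] that by simp
  have uCk: "Ck_on k u ?P" for k
  proof (induction k)
    case 0
    then show ?case using uc by simp
  next
    case (Suc k)
    have uim: "u ` ?P \<subseteq> S" using uS by blast
    show ?case
    proof (rule Ck_on_SucI[OF op ud])
      fix v :: "real \<times> 'e"
      have "Ck_on k (\<lambda>p. W p (snd v)) ?P"
      proof (rule linear_kint_Ck[OF Z _ Ck_on_const _ _ L(2,3) Wv])
        show "Ck_on k (\<lambda>q. fderiv F (u q)) ?P"
          by (rule Ck_on_compose[OF op Suc.IH Ck_on_fderiv[OF S(1) FCk] uim])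
        show "continuous_on ?P (\<lambda>p. W p (snd v))" by (intro continuous_intros Wc)
        show "norm (fderiv F (u p)) \<le> L" if "p \<in> ?P" for p
          using L(1)[OF uS[OF that]] .
      qed
      then show "Ck_on k (\<lambda>p. fst v *\<^sub>R F (u p) + W p (snd v)) ?P"
        by (intro Ck_on_add Ck_on_scaleR op Ck_on_const Ck_on_compose[OF op Suc.IH FCk uim])
    qed
  qed
  then show "smooth_on u ?P" by (simp add: smooth_on_def)
  have u': "fderiv u p v = fst v *\<^sub>R F (u p) + W p (snd v)" if "p \<in> ?P" for p v
    using has_derivative_unique[OF fderiv_has_derivative[OF uCk that] ud[OF that]] by metis
  show "fderiv u p (1, 0) = F (u p)" if "p \<in> ?P"
    using u'[OF that] by simp
  show "fderiv u p (0, F (snd p)) = F (u p)" if p: "p \<in> ?P"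
  proof -
    \<comment> \<open>With \<open>z = snd p\<close>, both \<open>W p (F z)\<close> and
      \<open>F (u p)\<close> solve
      \<open>y p = F z + kint (\<lambda>q. fderiv F (u q) (y q)) p\<close>: the first by the
      variational equation, the second by the chain rule along the trajectory.\<close>
    have "W p (F (snd p)) - F (u p) = 0"
    proof (rule kint_unique[OF _ F'uc L(1)[OF uS] L(2,3) _ p])
      have "continuous_on ?P (\<lambda>p. F (snd p))"
        using ZS by (intro continuous_on_compose2[OF Fc] continuous_intros) auto
      then show yc: "continuous_on ?P (\<lambda>p. W p (F (snd p)) - F (u p))"
        by (intro continuous_on_diff blinfun.continuous_on Wc Fuc)
      fix p assume p: "p \<in> ?P"
      obtain t z where ptz: "p = (t, z)" by (cases p)
      have WF: "continuous_on ?P (\<lambda>q. fderiv F (u q) (W q (F z)))"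
        by (intro blinfun.continuous_on F'uc Wc continuous_on_const)
      have FF: "continuous_on ?P (\<lambda>q. fderiv F (u q) (F (u q)))"
        by (intro blinfun.continuous_on F'uc Fuc)
      have "F (u (t, z)) - F (u (0, z)) = kint (\<lambda>q. fderiv F (u q) (F (u q))) (t, z)"
      proof (rule kint_FTC)
        fix t z assume tz: "(t, z) \<in> ?P"
        have "((\<lambda>t. F (u (t, z))) has_derivative (\<lambda>h. fderiv F (u (t, z)) (h *\<^sub>R F (u (t, z))))) (at t)"
          using has_derivative_compose[OF ut[OF tz, unfolded has_vector_derivative_def] Fd[OF uS[OF tz]]] .
        then show "((\<lambda>t. F (u (t, z))) has_vector_derivative fderiv F (u (t, z)) (F (u (t, z)))) (at t)"
          by (simp only: has_vector_derivative_def blinfun.scaleR_right)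
      qed (use p ptz in simp)
      moreover have "u (0, z) = z"
        using ueq[of "(0, z)"] p ptz by (auto simp: kint_zero_time dist_norm)
      ultimately have "F (u p) = F z + kint (\<lambda>q. fderiv F (u q) (F (u q))) p"
        by (simp add: ptz diff_eq_eq add.commute)
      then have "W p (F z) - F (u p) = kint (\<lambda>q. fderiv F (u q) (W q (F z))) p -
          kint (\<lambda>q. fderiv F (u q) (F (u q))) p"
        using Wv[OF p, of "F z"] ptz by simp
      also have "\<dots> = kint (\<lambda>q. fderiv F (u q) (W q (F z)) - fderiv F (u q) (F (u q))) p"
        by (rule kint_diff[symmetric, OF WF FF p])
      also have "\<dots> = kint (\<lambda>q. fderiv F (u q) (W q (F (snd q)) - F (u q))) p"
        by (rule kint_cong) (simp add: ptz blinfun.diff_right)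
      finally show "W p (F (snd p)) - F (u p) = kint (\<lambda>q. fderiv F (u q) (W q (F (snd q)) - F (u q))) p"
        by (simp add: ptz)
    qed simp
    then show ?thesis using u'[OF p] by simp
  qed
qed

lemma flow_exists:
  fixes F :: "'e::euclidean_space \<Rightarrow> 'e"
  assumes "open X" "smooth_on F X" "z0 \<in> X"
  shows "\<exists>d r (u :: real \<times> 'e \<Rightarrow> 'e). 0 < d \<and> 0 < r \<and> ball z0 r \<subseteq> X \<and> smooth_on u (ball 0 d \<times> ball z0 r) \<and>
    (\<forall>z\<in>ball z0 r. u (0, z) = z) \<and>
    (\<forall>p\<in>ball 0 d \<times> ball z0 r. fderiv u p (1, 0) = F (u p) \<and> fderiv u p (0, F (snd p)) = F (u p))"
proof -
  have FCk: "Ck_on k F X" for k using assms(2) by (simp add: smooth_on_def)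
  obtain R where R: "0 < R" "cball z0 R \<subseteq> X"
    using assms(1,3) by (auto simp: open_contains_cball)
  have bd: "\<exists>B\<ge>0. \<forall>x\<in>cball z0 R. norm (f x) \<le> B"
    if "continuous_on X f" for f :: "'e \<Rightarrow> 'f::real_normed_vector"
  proof -
    have "bounded (f ` cball z0 R)"
      by (intro compact_imp_bounded compact_continuous_image continuous_on_subset[OF that R(2)] compact_cball)
    then obtain B where B: "\<forall>x\<in>f ` cball z0 R. norm x \<le> B" unfolding bounded_iff by (rule exE)
    have "norm (f z0) \<le> B" using B R(1) by simp
    then have "0 \<le> B" using norm_ge_zero order_trans by blast
    then show ?thesis using B by (intro exI[of _ B]) simp
  qed
  obtain M where M: "0 \<le> M" "\<And>x. x \<in> cball z0 R \<Longrightarrow> norm (F x) \<le> M"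
    using bd[OF Ck_on_continuous[OF FCk]] by auto
  obtain L where L: "0 \<le> L" "\<And>x. x \<in> cball z0 R \<Longrightarrow> norm (fderiv F x) \<le> L"
    using bd[OF Ck_on_continuous[OF Ck_on_fderiv[OF assms(1) FCk]]] by auto
  \<comment> \<open>Points start within \<open>r\<close> of \<open>z0\<close> and move by at most
    \<open>d * M \<le> r\<close>, so they stay within \<open>2 * r < R\<close>; hence a third of
    \<open>R\<close>. The other bound on \<open>d\<close> gives \<open>d * L \<le> 1/2\<close>.
    Adding 1 to \<open>L\<close> and \<open>M\<close> avoids division by zero.\<close>
  define r where "r = R / 3"
  define d where "d = min (1 / (2 * (L + 1))) (r / (M + 1))"
  have r: "0 < r" using R by (simp add: r_def)
  have d: "0 < d" using r L M by (simp add: d_def)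
  have "d * L \<le> 1 / (2 * (L + 1)) * L" using L by (intro mult_right_mono) (simp_all add: d_def)
  also have "\<dots> \<le> 1/2" using L by (simp add: field_simps)
  finally have dL: "d * L \<le> 1/2" .
  have "d * M \<le> r / (M + 1) * M" using M by (intro mult_right_mono) (simp_all add: d_def)
  also have "\<dots> \<le> r" using M r by (simp add: field_simps)
  finally have dM: "d * M \<le> r" .
  let ?Z = "ball z0 r" let ?P = "ball (0::real) d \<times> ?Z" and ?S = "ball z0 R"
  have SX: "?S \<subseteq> X" using R(2) by auto
  have FS: "smooth_on F ?S"
    using Ck_on_subset[OF FCk SX] by (simp add: smooth_on_def)
  have CS: "cball z0 (2 * r) \<subseteq> ?S" using r by (auto simp: r_def)
  have F'c: "continuous_on ?S (fderiv F)"
    using continuous_on_subset[OF Ck_on_continuous[OF Ck_on_fderiv[OF assms(1) FCk]] SX] .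
  have lip: "norm (F y - F x) \<le> L * norm (y - x)" if "x \<in> ?S" "y \<in> ?S" for x y
  proof -
    have "F y - F x = hadamard (fderiv F) x y (y - x)"
      by (rule hadamard_diff[OF convex_ball F'c that fderiv_has_derivative[OF FCk]]) (use SX in blast)
    also have "norm \<dots> \<le> norm (hadamard (fderiv F) x y) * norm (y - x)" by (rule norm_blinfun)
    also have "\<dots> \<le> L * norm (y - x)"
      by (intro mult_right_mono norm_hadamard_le[OF convex_ball F'c that]) (use L in simp_all)
    finally show ?thesis .
  qed
  \<comment> \<open>A closed ball, so that the constraint survives limits; it still lies inside the
    open ball \<open>?S\<close> to which \<open>Ck_on_flow\<close> is applied.\<close>
  define Q where "Q u \<longleftrightarrow> continuous_on ?P u \<and> (\<forall>p\<in>?P. u p \<in> cball z0 (2 * r))" for u :: "real \<times> 'e \<Rightarrow> 'e"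
  define \<Phi> where "\<Phi> u p = snd p + kint (\<lambda>q. F (u q)) p" for u :: "real \<times> 'e \<Rightarrow> 'e" and p
  have Fu: "continuous_on ?P (\<lambda>q. F (u q))" if "Q u" for u
  proof (rule continuous_on_compose2[OF Ck_on_continuous[OF FCk]])
    show "continuous_on ?P u" using that by (simp add: Q_def)
    show "u ` ?P \<subseteq> X" using that CS SX unfolding Q_def by blast
  qed
  have kb: "norm (kint (\<lambda>q. F (u q)) p) \<le> r" if u: "Q u" and p: "p \<in> ?P" for u p
  proof -
    have "norm (kint (\<lambda>q. F (u q)) p) \<le> \<bar>fst p\<bar> * M"
    proof (rule norm_kint_le[OF Fu[OF u] p])
      fix s :: real assume "s \<in> {0..1}"
      from path_mem[OF p this] have "u (s * fst p, snd p) \<in> cball z0 (2 * r)"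
        using u unfolding Q_def by blast
      then show "norm (F (u (s * fst p, snd p))) \<le> M"
        by (intro M(2)) (use r in \<open>simp add: r_def\<close>)
    qed
    also have "\<dots> \<le> d * M" using p M(1) by (intro mult_right_mono) (auto simp: dist_norm)
    also note dM
    finally show ?thesis .
  qed
  have Q0: "Q snd"
    using r by (auto simp: Q_def intro!: continuous_on_snd continuous_on_id)
  have Q\<Phi>: "Q (\<Phi> u)" if u: "Q u" for u
    unfolding Q_def
  proof (intro conjI ballI)
    show "continuous_on ?P (\<Phi> u)"
      unfolding \<Phi>_def[abs_def]
      by (intro continuous_on_add kint_continuous Fu u continuous_on_snd continuous_on_id)
    fix p assume p: "p \<in> ?P"
    have "norm (\<Phi> u p - z0) \<le> norm (snd p - z0) + norm (kint (\<lambda>q. F (u q)) p)"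
      unfolding \<Phi>_def by norm
    then show "\<Phi> u p \<in> cball z0 (2 * r)"
      using kb[OF u p] p by (auto simp: dist_norm norm_minus_commute)
  qed
  have contr: "norm (\<Phi> u p - \<Phi> v p) \<le> m / 2"
    if u: "Q u" and v: "Q v" and m: "0 \<le> m"
      and le: "\<And>p. p \<in> ?P \<Longrightarrow> norm (u p - v p) \<le> m" and p: "p \<in> ?P" for u v m p
  proof -
    have "\<Phi> u p - \<Phi> v p = kint (\<lambda>q. F (u q) - F (v q)) p"
      using kint_diff[OF Fu[OF u] Fu[OF v] p] by (simp add: \<Phi>_def)
    also have "norm \<dots> \<le> \<bar>fst p\<bar> * (L * m)"
    proof (rule norm_kint_le[OF continuous_on_diff[OF Fu[OF u] Fu[OF v]] p])
      fix s :: real assume "s \<in> {0..1}"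
      from path_mem[OF p this] have q: "(s * fst p, snd p) \<in> ?P" (is "?q \<in> _") .
      have "u ?q \<in> ?S" "v ?q \<in> ?S" using u v q CS unfolding Q_def by blast+
      then have "norm (F (u ?q) - F (v ?q)) \<le> L * norm (u ?q - v ?q)" by (intro lip)
      also have "\<dots> \<le> L * m" using le[OF q] L(1) by (intro mult_left_mono)
      finally show "norm (F (u ?q) - F (v ?q)) \<le> L * m" .
    qed
    also have "\<dots> \<le> d * (L * m)"
      using p L(1) m by (intro mult_right_mono) (auto simp: dist_norm)
    also have "\<dots> \<le> 1/2 * m"
      using mult_right_mono[OF dL m] by (simp add: mult.assoc)
    finally show ?thesis by simp
  qed
  \<comment> \<open>The first correction is bounded on all of \<open>?P\<close>, so here the
    iteration converges uniformly on the whole domain.\<close>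
  have init: "norm (\<Phi> snd p - snd p) \<le> r" if "p \<in> ?P" for p
    using kb[OF Q0 that] by (simp add: \<Phi>_def)
  define u where "u p = lim (\<lambda>n. (\<Phi> ^^ n) snd p)" for p
  have u_eq: "u = (\<lambda>p. lim (\<lambda>n. (\<Phi> ^^ n) snd p))" by (rule ext) (rule u_def)
  have ulim: "uniform_limit ?P (\<lambda>n. (\<Phi> ^^ n) snd) u sequentially"
    unfolding u_eq by (rule picard_uniform_limit(1)[of Q snd \<Phi> ?P r, OF Q0 Q\<Phi> contr init])
  have Qn: "Q ((\<Phi> ^^ n) snd)" for n
    by (induction n) (simp_all add: Q0 Q\<Phi>)
  have Qu: "Q u"
    unfolding Q_def
  proof (intro conjI ballI)
    show "continuous_on ?P u"
      by (rule uniform_limit_theorem[OF _ ulim]) (use Qn in \<open>simp_all add: Q_def\<close>)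
    fix p assume p: "p \<in> ?P"
    show "u p \<in> cball z0 (2 * r)"
    proof (rule Lim_in_closed_set[OF closed_cball])
      show "\<forall>\<^sub>F n in sequentially. (\<Phi> ^^ n) snd p \<in> cball z0 (2 * r)"
        using Qn p unfolding Q_def by (intro always_eventually allI) blast
      show "(\<lambda>n. (\<Phi> ^^ n) snd p) \<longlonglongrightarrow> u p"
        by (rule tendsto_uniform_limitI[OF ulim p])
    qed simp
  qed
  have ueq: "u p = snd p + kint (\<lambda>q. F (u q)) p" if "p \<in> ?P" for p
  proof -
    have "\<Phi> u p = u p"
      unfolding u_eq
      by (rule picard_uniform_limit(2)[of Q snd \<Phi> ?P r, OF Q0 Q\<Phi> contr init _ that]) (use Qu in \<open>simp_all add: u_eq\<close>)
    then show ?thesis by (simp add: \<Phi>_def)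
  qed
  have uS: "u p \<in> ?S" if "p \<in> ?P" for p
    using Qu CS that unfolding Q_def by blast
  have uc: "continuous_on ?P u" using Qu by (simp add: Q_def)
  have ZS: "?Z \<subseteq> ?S" using r by (auto simp: r_def)
  have LS: "norm (fderiv F x) \<le> L" if "x \<in> ?S" for x using L(2) that by simp
  note flow = Ck_on_flow[OF open_ball convex_ball open_ball convex_ball FS LS dL L(1) uc uS ueq ZS]
  have u0: "u (0, z) = z" if "z \<in> ?Z" for z
    using ueq[of "(0, z)"] that d by (simp add: kint_zero_time)
  have ZX: "?Z \<subseteq> X" using ZS SX by blast
  show ?thesis
    by (rule exI[of _ d], rule exI[of _ r], rule exI[of _ u])
      (intro conjI ballI flow u0 d r ZX)
qed


section \<open>First integrals\<close>

definition inl_blinfun :: "'a::real_normed_vector \<Rightarrow>\<^sub>L ('a \<times> 'b::real_normed_vector)" where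
  "inl_blinfun = Blinfun (\<lambda>v. (v, 0))"

lemma inl_blinfun_apply [simp]: "blinfun_apply inl_blinfun v = (v, 0)"
  unfolding inl_blinfun_def
  by (subst bounded_linear_Blinfun_apply)
    (auto intro: bounded_linear_Pair bounded_linear_zero bounded_linear_ident)

text \<open>An injective linear map on a Euclidean space is bounded below by some
  \<open>B > 0\<close>, and a perturbation of operator norm less than \<open>B\<close> cannot create
  a kernel.\<close>

lemma injective_blinfun_nbhd:
  fixes T :: "'a::topological_space \<Rightarrow> 'b::euclidean_space \<Rightarrow>\<^sub>L 'c::euclidean_space"
  assumes "open N" "z0 \<in> N" "continuous_on N T" "\<And>v. T z0 v = 0 \<Longrightarrow> v = 0"
  shows "\<exists>N'. open N' \<and> z0 \<in> N' \<and> N' \<subseteq> N \<and> (\<forall>z\<in>N'. \<forall>v. T z v = 0 \<longrightarrow> v = 0)"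
proof -
  have lin: "linear (blinfun_apply (T z0))"
    by (rule bounded_linear.linear[OF blinfun.bounded_linear_right])
  then have "inj (blinfun_apply (T z0))"
    using assms(4) by (simp add: linear_injective_0)
  with lin obtain B where B: "0 < B" "\<And>v. B * norm v \<le> norm (T z0 v)"
    using linear_inj_bounded_below_pos by blast
  define N' where "N' = {z \<in> N. norm (T z - T z0) < B}"
  have "open (N \<inter> (\<lambda>z. norm (T z - T z0)) -` {..<B})"
    by (intro continuous_open_preimage continuous_intros assms(1,3) open_lessThan)
  also have "N \<inter> (\<lambda>z. norm (T z - T z0)) -` {..<B} = N'" by (auto simp: N'_def)
  finally have "open N'" .
  moreover have "v = 0" if z: "z \<in> N'" and v: "T z v = 0" for z v
  proof (rule ccontr)
    assume "v \<noteq> 0"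
    have "B * norm v \<le> norm (T z0 v)" by (rule B)
    also have "T z0 v = - (T z - T z0) v" using v by (simp add: blinfun.diff_left blinfun.minus_left)
    also have "norm \<dots> \<le> norm (T z - T z0) * norm v"
      using norm_blinfun[of "T z - T z0" v] by (simp add: blinfun.minus_left)
    also have "\<dots> < B * norm v"
      using z \<open>v \<noteq> 0\<close> by (intro mult_strict_right_mono) (simp_all add: N'_def)
    finally show False by simp
  qed
  ultimately show ?thesis
    using assms(2) B(1) by (intro exI[of _ N']) (auto simp: N'_def)
qed

text \<open>Compose the orthogonal projection along \<open>a\<close> with a linear isometry from its
  image plane to \<open>real ^ 2\<close>. The kernel is written through the functional
  \<open>v \<bullet> a / (a \<bullet> a)\<close>, so that \<open>p\<close> is visibly injective
  where this functional vanishes.\<close>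

lemma plane_projection_along:
  fixes a :: "real ^ 3"
  assumes "a \<noteq> 0"
  shows "\<exists>p :: real ^ 3 \<Rightarrow> real ^ 2. linear p \<and> (\<forall>v. p v = 0 \<longleftrightarrow> v = ((v \<bullet> a) / (a \<bullet> a)) *\<^sub>R a)"
proof -
  let ?H = "{x. a \<bullet> x = 0}"
  have "dim ?H = dim (UNIV :: (real ^ 2) set)"
    using dim_hyperplane[OF assms] by simp
  then obtain f :: "real ^ 3 \<Rightarrow> real ^ 2" where f: "linear f" "\<And>x. x \<in> ?H \<Longrightarrow> norm (f x) = norm x"
    using isometries_subspaces[OF subspace_hyperplane subspace_UNIV] by metis
  define q where "q v = v - ((v \<bullet> a) / (a \<bullet> a)) *\<^sub>R a" for v
  have q: "linear q"
    by (rule linearI) (simp_all add: q_def algebra_simps inner_add_left add_divide_distrib)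
  have "f (q v) = 0 \<longleftrightarrow> v = ((v \<bullet> a) / (a \<bullet> a)) *\<^sub>R a" for v
  proof -
    have "q v \<in> ?H" using assms by (simp add: q_def inner_diff_right inner_commute)
    from f(2)[OF this] have "f (q v) = 0 \<longleftrightarrow> q v = 0" by (metis norm_eq_zero)
    then show ?thesis by (simp add: q_def)
  qed
  with linear_compose[OF q f(1)] show ?thesis
    by (intro exI[of _ "f \<circ> q"]) simp
qed

text \<open>Normalise \<open>F\<close> so that a linear functional takes the value 1 on it, and follow the flow from
  \<open>z\<close> back to the hyperplane through \<open>z0\<close> on which this functional is constant.\<close>

lemma first_integrals:
  fixes F :: "real ^ 3 \<Rightarrow> real ^ 3"
  assumes "open X" "smooth_on F X" "z0 \<in> X" "F z0 \<noteq> 0"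
  shows "\<exists>N (f :: real ^ 3 \<Rightarrow> real ^ 2). open N \<and> z0 \<in> N \<and> N \<subseteq> X \<and> smooth_on f N \<and>
    (\<forall>z\<in>N. \<forall>v. fderiv f z v = 0 \<longleftrightarrow> (\<exists>t. v = t *\<^sub>R F z))"
proof -
  define a where "a = F z0"
  \<comment> \<open>The orthogonal coordinate along \<open>F z0\<close>, scaled so that
    \<open>lam (F z0) = 1\<close>.\<close>
  define lam where "lam v = (v \<bullet> a) / (a \<bullet> a)" for v
  have a: "a \<bullet> a \<noteq> 0" using assms(4) by (simp add: a_def)
  have lam: "bounded_linear lam"
    unfolding lam_def[abs_def]
    by (intro bounded_linear_divide[THEN bounded_linear_compose] bounded_linear_inner_left)
  have FCk: "Ck_on k F X" for k using assms(2) by (simp add: smooth_on_def)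
  have lamF: "Ck_on k (\<lambda>z. lam (F z)) X" for k
    by (rule Ck_on_bounded_linear[OF lam assms(1) FCk])
  define X1 where "X1 = {z \<in> X. lam (F z) \<noteq> 0}"
  have X1: "open X1"
  proof -
    have "open (X \<inter> (\<lambda>z. lam (F z)) -` (- {0}))"
      by (intro continuous_open_preimage Ck_on_continuous[OF lamF] assms(1)) auto
    also have "X \<inter> (\<lambda>z. lam (F z)) -` (- {0}) = X1" by (auto simp: X1_def)
    finally show ?thesis .
  qed
  have z01: "z0 \<in> X1" using a assms(3) by (simp add: X1_def lam_def a_def[symmetric])
  have X1X: "X1 \<subseteq> X" by (auto simp: X1_def)
  \<comment> \<open>Along the flow of \<open>G\<close> the coordinate \<open>lam\<close> grows at
    unit speed. The trajectory of \<open>z\<close> thus meets the hyperplane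
    \<open>lam (x - z0) = 0\<close> at time \<open>- lam (z - z0)\<close>, the time component of
    \<open>T\<close> below.\<close>
  define G where "G z = inverse (lam (F z)) *\<^sub>R F z" for z
  have G: "smooth_on G X1"
    unfolding smooth_on_def G_def[abs_def]
    by (intro allI Ck_on_scaleR X1 Ck_on_inverse Ck_on_subset[OF FCk X1X] Ck_on_subset[OF lamF X1X])
      (simp add: X1_def)
  have lamG: "lam (G z) = 1" if "z \<in> X1" for z
    using that by (simp add: G_def X1_def linear_cmul[OF bounded_linear.linear[OF lam]])
  have Gz0: "G z0 = a" using a by (simp add: G_def lam_def a_def)
  obtain d r and u :: "real \<times> (real ^ 3) \<Rightarrow> real ^ 3" where flow:
    "0 < d \<and> 0 < r \<and> ball z0 r \<subseteq> X1 \<and> smooth_on u (ball 0 d \<times> ball z0 r) \<and>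
    (\<forall>z\<in>ball z0 r. u (0, z) = z) \<and>
    (\<forall>p\<in>ball 0 d \<times> ball z0 r. fderiv u p (1, 0) = G (u p) \<and> fderiv u p (0, G (snd p)) = G (u p))"
    using flow_exists[OF X1 G z01] by (elim exE)
  then have dr: "0 < d" "0 < r" and rX: "ball z0 r \<subseteq> X1"
    and u: "smooth_on u (ball 0 d \<times> ball z0 r)"
    and u0: "\<And>z. z \<in> ball z0 r \<Longrightarrow> u (0, z) = z"
    and ut: "\<And>p. p \<in> ball 0 d \<times> ball z0 r \<Longrightarrow> fderiv u p (1, 0) = G (u p)"
    and uG: "\<And>p. p \<in> ball 0 d \<times> ball z0 r \<Longrightarrow> fderiv u p (0, G (snd p)) = G (u p)"
    by blast+
  have uCk: "Ck_on k u (ball 0 d \<times> ball z0 r)" for k using u by (simp add: smooth_on_def)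
  obtain p :: "real ^ 3 \<Rightarrow> real ^ 2" where p: "linear p" "\<And>v. p v = 0 \<longleftrightarrow> v = lam v *\<^sub>R a"
    using plane_projection_along[of a] a unfolding lam_def by (metis inner_zero_left)
  have pbl: "bounded_linear p" using p(1) by (simp add: linear_conv_bounded_linear)
  define T where "T z = (- lam (z - z0), z)" for z
  define f where "f z = p (u (T z))" for z
  define N1 where "N1 = ball z0 r \<inter> (\<lambda>z. lam (z - z0)) -` ball 0 d"
  have N1: "open N1"
    unfolding N1_def
    by (intro continuous_open_preimage bounded_linear.continuous_on[OF lam] continuous_intros) auto
  have TN: "T z \<in> ball 0 d \<times> ball z0 r" if "z \<in> N1" for z
    using that by (auto simp: T_def N1_def dist_norm)
  have z0N: "z0 \<in> N1"
    using dr linear_0[OF bounded_linear.linear[OF lam]] by (simp add: N1_def)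
  have TCk: "Ck_on k T N1" for k
    unfolding T_def[abs_def]
    by (intro Ck_on_Pair Ck_on_uminus N1 Ck_on_bounded_linear[OF lam] Ck_on_diff Ck_on_ident Ck_on_const)
  have fCk: "Ck_on k f N1" for k
    unfolding f_def[abs_def]
    by (intro Ck_on_bounded_linear[OF pbl N1] Ck_on_compose[OF N1 TCk uCk]) (use TN in blast)
  have Td: "(T has_derivative (\<lambda>v. (- lam v, v))) (at z)" for z
  proof -
    have "((\<lambda>z. lam (z - z0)) has_derivative (\<lambda>v. lam (v - 0))) (at z)"
      by (intro bounded_linear.has_derivative[OF lam] has_derivative_diff has_derivative_ident
          has_derivative_const)
    then show ?thesis
      unfolding T_def[abs_def]
      by (intro has_derivative_Pair has_derivative_minus has_derivative_ident) simp
  qed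
  have f': "fderiv f z v = p (fderiv u (T z) (0, v) - lam v *\<^sub>R G (u (T z)))" if z: "z \<in> N1" for z v
  proof -
    have "(u has_derivative fderiv u (T z)) (at (T z))"
      by (rule fderiv_has_derivative[OF uCk TN[OF z]])
    from has_derivative_compose[OF Td this]
    have "((\<lambda>z. u (T z)) has_derivative (\<lambda>v. fderiv u (T z) (- lam v, v))) (at z)" .
    from bounded_linear.has_derivative[OF pbl this]
    have "(f has_derivative (\<lambda>v. p (fderiv u (T z) (- lam v, v)))) (at z)"
      by (simp only: f_def[abs_def])
    from fun_cong[OF has_derivative_unique[OF fderiv_has_derivative[OF fCk z] this]]
    have "fderiv f z v = p (fderiv u (T z) (- lam v, v))" .
    also have "(- lam v, v) = (0, v) - lam v *\<^sub>R (1, 0)" by simp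
    also have "fderiv u (T z) \<dots> = fderiv u (T z) (0, v) - lam v *\<^sub>R G (u (T z))"
      by (simp only: blinfun.diff_right blinfun.scaleR_right ut[OF TN[OF z]])
    finally show ?thesis .
  qed
  have u'0: "fderiv u (0, z0) (0, v) = v" for v
  proof -
    have "((\<lambda>y. u (0, y)) has_derivative (fderiv u (0, z0) o\<^sub>L inr_blinfun)) (at z0)"
      using dr by (intro has_derivative_space_slice fderiv_has_derivative[OF uCk]) simp
    moreover have "((\<lambda>y. u (0, y)) has_derivative (\<lambda>v. v)) (at z0)"
      by (rule has_derivative_transform_within_open[OF has_derivative_ident open_ball[of z0 r]])
        (use dr u0 in simp_all)
    ultimately have "blinfun_apply (fderiv u (0, z0) o\<^sub>L inr_blinfun) = (\<lambda>v. v)"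
      by (rule has_derivative_unique)
    from fun_cong[OF this, of v] show ?thesis by simp
  qed
  have lam0: "lam 0 = 0" by (rule linear_0[OF bounded_linear.linear[OF lam]])
  \<comment> \<open>At \<open>z0\<close> the derivative of \<open>f\<close> agrees with
    \<open>p\<close> on the kernel of \<open>lam\<close>, where \<open>p\<close> is
    injective.\<close>
  have f'0: "fderiv f z0 v = 0 \<Longrightarrow> lam v = 0 \<Longrightarrow> v = 0" for v
    using f'[OF z0N, of v] p(2)[of v] by (simp add: T_def lam0 u'0)
  \<comment> \<open>Pairing \<open>fderiv f z\<close> with \<open>lam\<close> gives an operator that
    is injective at \<open>z0\<close>, hence nearby. The kernel of \<open>fderiv f z\<close> then
    meets that of \<open>lam\<close> only in 0, so it is at most a line.\<close>
  define Q where "Q z = (inl_blinfun o\<^sub>L fderiv f z) + (inr_blinfun o\<^sub>L Blinfun lam)" for z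
  have Q: "Q z v = (fderiv f z v, lam v)" for z v
    by (simp add: Q_def blinfun.add_left bounded_linear_Blinfun_apply[OF lam])
  have "continuous_on N1 Q"
    unfolding Q_def[abs_def]
    by (intro continuous_on_add bounded_bilinear.continuous_on[OF bounded_bilinear_blinfun_compose]
        continuous_on_const Ck_on_continuous[OF Ck_on_fderiv[OF N1 fCk]])
  from injective_blinfun_nbhd[OF N1 z0N this]
  obtain N where N: "open N" "z0 \<in> N" "N \<subseteq> N1" "\<And>z v. z \<in> N \<Longrightarrow> Q z v = 0 \<Longrightarrow> v = 0"
    using f'0 by (auto simp: Q zero_prod_def)
  \<comment> \<open>Moving the starting point along \<open>G z\<close> moves the end point by
    \<open>G (u (T z))\<close>, while the travel time drops at unit rate because
    \<open>lam (G z) = 1\<close>; the two effects cancel.\<close>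
  have ker: "fderiv f z (G z) = 0" if "z \<in> N1" for z
  proof -
    have "z \<in> X1" using that rX by (auto simp: N1_def)
    then show ?thesis
      using f'[OF that, of "G z"] uG[OF TN[OF that]] lamG linear_0[OF p(1)] by (simp add: T_def)
  qed
  have "fderiv f z v = 0 \<longleftrightarrow> (\<exists>t. v = t *\<^sub>R F z)" if z: "z \<in> N" for z v
  proof -
    have zN1: "z \<in> N1" and zX1: "z \<in> X1" using z N(3) rX by (auto simp: N1_def)
    have FG: "F z = lam (F z) *\<^sub>R G z" using zX1 by (simp add: G_def X1_def)
    show ?thesis
    proof
      assume v: "fderiv f z v = 0"
      \<comment> \<open>Removing the \<open>lam\<close>-component along \<open>G z\<close> leaves a
        vector in both kernels.\<close>
      have "Q z (v - lam v *\<^sub>R G z) = 0"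
        by (simp add: Q blinfun.diff_right blinfun.scaleR_right v ker[OF zN1] zero_prod_def
            linear_diff[OF bounded_linear.linear[OF lam]] linear_cmul[OF bounded_linear.linear[OF lam]]
            lamG[OF zX1])
      then have "v = lam v *\<^sub>R G z" using N(4)[OF z] by fastforce
      then show "\<exists>t. v = t *\<^sub>R F z" unfolding G_def by (metis scaleR_scaleR)
    next
      assume "\<exists>t. v = t *\<^sub>R F z"
      then obtain t where "v = t *\<^sub>R F z" by (rule exE)
      then have "v = (t * lam (F z)) *\<^sub>R G z" using FG by (metis scaleR_scaleR)
      then show "fderiv f z v = 0" by (simp add: blinfun.scaleR_right ker[OF zN1])
    qed
  qed
  moreover have "smooth_on f N"
    using Ck_on_subset[OF fCk N(3)] by (simp add: smooth_on_def)
  moreover have "N \<subseteq> X" using N(3) rX X1X by (auto simp: N1_def)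
  ultimately show ?thesis using N(1,2) by (intro exI[of _ N] exI[of _ f]) simp
qed


section \<open>Smooth inverses and parametrised hypersurfaces\<close>

lemma Ck_on_vec:
  fixes f :: "'a::real_normed_vector \<Rightarrow> real ^ 'n"
  assumes "open S" "\<And>i. Ck_on k (\<lambda>x. f x $ i) S"
  shows "Ck_on k f S"
proof -
  have "Ck_on k (\<lambda>x. \<Sum>i\<in>UNIV. (f x $ i) *\<^sub>R axis i (1::real)) S"
    by (intro Ck_on_sum Ck_on_scaleR assms Ck_on_const)
  moreover have "(\<Sum>i\<in>UNIV. (f x $ i) *\<^sub>R axis i 1) = f x" for x
    using basis_expansion[of "f x"] by (simp add: scalar_mult_eq_scaleR)
  ultimately show ?thesis by simp
qed

lemma Ck_on_det:
  fixes A :: "'a::real_normed_vector \<Rightarrow> real ^ 'n ^ 'n"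
  assumes "open S" "\<And>i j. Ck_on k (\<lambda>x. A x $ i $ j) S"
  shows "Ck_on k (\<lambda>x. det (A x)) S"
  unfolding det_def
  by (intro Ck_on_sum Ck_on_mult Ck_on_prod Ck_on_const assms)

text \<open>By Cramer's rule the components of the solution are quotients of determinants, that is
  of polynomials in the coefficients and the right-hand side.\<close>

lemma Ck_on_linear_system:
  fixes A :: "'a::real_normed_vector \<Rightarrow> (real ^ 'n) \<Rightarrow>\<^sub>L (real ^ 'n)"
  assumes "open S" "Ck_on k A S" "Ck_on k b S"
    and "\<And>x. x \<in> S \<Longrightarrow> inj (blinfun_apply (A x))" "\<And>x. x \<in> S \<Longrightarrow> A x (w x) = b x"
  shows "Ck_on k w S"
proof -
  define M where "M x = matrix (blinfun_apply (A x))" for x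
  define C where "C l x = (\<chi> i j. if j = l then b x $ i else M x $ i $ j)" for l x
  have lin: "linear (blinfun_apply (A x))" for x
    by (rule bounded_linear.linear[OF blinfun.bounded_linear_right])
  have det: "det (M x) \<noteq> 0" if "x \<in> S" for x
    using det_nz_iff_inj[OF lin] assms(4)[OF that] by (simp add: M_def)
  have w: "w x $ l = det (C l x) * inverse (det (M x))" if "x \<in> S" for x l
  proof -
    have "M x *v w x = b x"
      using assms(5)[OF that] by (simp add: M_def matrix_vector_mul(2)[OF lin])
    then have "w x = (\<chi> k. det (\<chi> i j. if j = k then b x $ i else M x $ i $ j) / det (M x))"
      using cramer[OF det[OF that]] by blast
    then have "w x $ l = (\<chi> k. det (\<chi> i j. if j = k then b x $ i else M x $ i $ j) / det (M x)) $ l"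
      by (rule arg_cong)
    then show ?thesis by (simp add: C_def divide_inverse)
  qed
  have MCk: "Ck_on k (\<lambda>x. M x $ i $ j) S" for i j
  proof -
    have "Ck_on k (\<lambda>x. A x (axis j 1) $ i) S"
      by (intro Ck_on_bounded_linear[OF bounded_linear_vec_nth] assms(1)
          Ck_on_bilinear[OF bounded_bilinear_blinfun_apply] assms(2) Ck_on_const)
    then show ?thesis by (simp add: M_def matrix_def)
  qed
  have CCk: "Ck_on k (\<lambda>x. C l x $ i $ j) S" for l i j
    using MCk Ck_on_bounded_linear[OF bounded_linear_vec_nth assms(1,3)]
    by (cases "j = l") (simp_all add: C_def)
  show ?thesis
  proof (rule Ck_on_vec[OF assms(1)])
    fix l
    have "Ck_on k (\<lambda>x. det (C l x) * inverse (det (M x))) S"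
      by (intro Ck_on_mult assms(1) Ck_on_det CCk Ck_on_inverse MCk det)
    then show "Ck_on k (\<lambda>x. w x $ l) S"
      by (rule Ck_on_cong_imp[OF assms(1)]) (rule w[symmetric])
  qed
qed

text \<open>For fixed \<open>v\<close> the vector \<open>g' y v\<close> solves the linear system
  with operator \<open>fderiv f (g y)\<close> and right-hand side \<open>v\<close>. Its coefficients
  have the regularity already known for \<open>g\<close>, so each order yields the next, starting
  from the continuous inverse.\<close>

lemma smooth_inverse_function:
  fixes f :: "real ^ 'n \<Rightarrow> real ^ 'n"
  assumes "open U" "smooth_on f U" "x0 \<in> U" "\<And>v. fderiv f x0 v = 0 \<Longrightarrow> v = 0"
  shows "\<exists>U' V g. open U' \<and> U' \<subseteq> U \<and> x0 \<in> U' \<and> open V \<and> homeomorphism U' V f g \<and> smooth_on g V"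
proof -
  have fCk: "Ck_on k f U" for k using assms(2) by (simp add: smooth_on_def)
  have lin: "linear (blinfun_apply (fderiv f x))" for x
    by (rule bounded_linear.linear[OF blinfun.bounded_linear_right])
  have "inj (blinfun_apply (fderiv f x0))"
    using assms(4) linear_injective_0[OF lin] by blast
  then obtain h where h: "linear h" "h \<circ> blinfun_apply (fderiv f x0) = id"
    using linear_injective_left_inverse[OF lin] by blast
  have left_inv: "Blinfun h o\<^sub>L fderiv f x0 = id_blinfun"
    using fun_cong[OF h(2)] h(1)
    by (intro blinfun_eqI) (simp add: bounded_linear_Blinfun_apply linear_conv_bounded_linear)
  show ?thesis
  proof (rule inverse_function_theorem[OF assms(1) fderiv_has_derivative[OF fCk]
        Ck_on_continuous[OF Ck_on_fderiv[OF assms(1) fCk]] assms(3) left_inv])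
    fix U' V g g' assume U': "open U'" "U' \<subseteq> U" "x0 \<in> U'" and V: "open V"
      and hom: "homeomorphism U' V f g"
      and g': "\<And>y. y \<in> V \<Longrightarrow> (g has_derivative g' y) (at y)"
      and g'_eq: "\<And>y. y \<in> V \<Longrightarrow> g' y = inv (blinfun_apply (fderiv f (g y)))"
      and bij: "\<And>y. y \<in> V \<Longrightarrow> bij (blinfun_apply (fderiv f (g y)))"
    have gV: "g ` V \<subseteq> U" using hom U'(2) by (auto simp: homeomorphism_def)
    have "Ck_on k g V" for k
    proof (induction k)
      case 0
      then show ?case using hom by (simp add: homeomorphism_def)
    next
      case (Suc k)
      show ?case
      proof (rule Ck_on_SucI[OF V g'])
        fix v
        show "Ck_on k (\<lambda>y. g' y v) V"
        proof (rule Ck_on_linear_system[OF V])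
          show "Ck_on k (\<lambda>y. fderiv f (g y)) V"
            by (rule Ck_on_compose[OF V Suc.IH Ck_on_fderiv[OF assms(1) fCk] gV])
          show "inj (blinfun_apply (fderiv f (g y)))" if "y \<in> V" for y
            using bij[OF that] by (rule bij_is_inj)
          show "fderiv f (g y) (g' y v) = v" if "y \<in> V" for y
            unfolding g'_eq[OF that] using bij[OF that] by (simp add: surj_f_inv_f bij_is_surj)
        qed (rule Ck_on_const)
      qed
    qed
    then have "smooth_on g V" by (simp add: smooth_on_def)
    with U' V hom show ?thesis by (intro exI[of _ U'] exI[of _ V] exI[of _ g] conjI)
  qed
qed

text \<open>Linear coordinates adapted to the hyperplane \<open>range L\<close>: \<open>P\<close>
  reads positions along it, \<open>k\<close> is its normal, and together they separate points. The
  vector \<open>k'\<close> is a direction that \<open>P\<close> does not see and \<open>k\<close>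
  does.\<close>

lemma hyperplane_complement:
  fixes L :: "real ^ 'n \<Rightarrow> 'b::euclidean_space"
  assumes "linear L" "inj L" "DIM('b) = CARD('n) + 1"
  shows "\<exists>P k k'. linear P \<and> (\<forall>v. P (L v) = v) \<and> P k' = 0 \<and> k \<bullet> k' \<noteq> 0 \<and>
    (\<forall>q. P q = 0 \<longrightarrow> k \<bullet> q = 0 \<longrightarrow> q = 0)"
proof -
  obtain P where P: "linear P" "P \<circ> L = id"
    using linear_injective_left_inverse[OF assms(1,2)] by blast
  have PL: "P (L v) = v" for v using fun_cong[OF P(2), of v] by simp
  have sub: "subspace (range L)"
    using assms(1) by (simp add: linear_subspace_image)
  have dimL: "dim (range L) = CARD('n)"
    using dim_image_eq[OF assms(1), of UNIV] assms(2) by (simp add: inj_on_subset)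
  then obtain k where k: "k \<noteq> 0" "span (range L) \<subseteq> {x. k \<bullet> x = 0}"
    using lowdim_subset_hyperplane[of "range L"] assms(3) by auto
  have "range L = {x. k \<bullet> x = 0}"
    using k(2) sub dimL dim_hyperplane[OF k(1)] assms(3)
    by (intro subspace_dim_equal subspace_hyperplane) (simp_all add: span_eq_iff[THEN iffD2])
  note H = this
  show ?thesis
  \<comment> \<open>The vector subtracted from \<open>k\<close> lies in \<open>range L\<close>: it
    has the same image under \<open>P\<close> and is orthogonal to \<open>k\<close>, so the inner
    product with \<open>k\<close> remains \<open>k \<bullet> k\<close>.\<close>
  proof (rule exI[of _ P], rule exI[of _ k], rule exI[of _ "k - L (P k)"], intro conjI allI impI P(1) PL)
    show "P (k - L (P k)) = 0" by (simp add: linear_diff[OF P(1)] PL)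
    have "k \<bullet> L (P k) = 0" using H by blast
    then show "k \<bullet> (k - L (P k)) \<noteq> 0" using k(1) by (simp add: inner_diff_right)
    show "q = 0" if "P q = 0" "k \<bullet> q = 0" for q
    proof -
      have "q \<in> range L" using that(2) H by blast
      then obtain v where "q = L v" by blast
      then show "q = 0" using that(1) PL linear_0[OF assms(1)] by metis
    qed
  qed
qed

text \<open>The composition of \<open>J\<close> with \<open>P\<close> has the identity as its
  derivative at \<open>z0\<close>, so it has a local inverse \<open>\<Theta>\<close>, and the image
  of \<open>J\<close> becomes a graph over an open set \<open>V\<close>. Sending \<open>q\<close> to
  \<open>J (\<Theta> (P q))\<close> retracts the open preimage of \<open>V\<close> under
  \<open>P\<close> onto this image; the defining function, the inverse of \<open>J\<close> and the
  tangent spaces all come from this retraction.\<close>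

lemma parametrised_hypersurface:
  fixes J :: "real ^ 'n \<Rightarrow> 'b::euclidean_space"
  assumes "open W" "smooth_on J W" "z0 \<in> W" "DIM('b) = CARD('n) + 1"
    and "\<And>v. fderiv J z0 v = 0 \<Longrightarrow> v = 0"
  shows "\<exists>U h. open U \<and> z0 \<in> U \<and> U \<subseteq> W \<and> homeomorphism U (J ` U) J h \<and> hypersurface (J ` U) \<and>
    (\<forall>z\<in>U. tangent_space_of (J ` U) (J z) = range (blinfun_apply (fderiv J z)))"
proof -
  have JCk: "Ck_on k J W" for k using assms(2) by (simp add: smooth_on_def)
  have J': "(J has_derivative fderiv J z) (at z)" if "z \<in> W" for z
    using fderiv_has_derivative[OF JCk that] .
  have lin: "linear (blinfun_apply (fderiv J z0))"
    by (rule bounded_linear.linear[OF blinfun.bounded_linear_right])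
  have "inj (blinfun_apply (fderiv J z0))"
    using assms(5) linear_injective_0[OF lin] by blast
  from hyperplane_complement[OF lin this assms(4)]
  obtain P k k' where Pk: "linear P \<and> (\<forall>v. P (fderiv J z0 v) = v) \<and> P k' = 0 \<and> k \<bullet> k' \<noteq> 0 \<and>
      (\<forall>q. P q = 0 \<longrightarrow> k \<bullet> q = 0 \<longrightarrow> q = 0)"
    by (elim exE)
  then have P: "linear P" "\<And>v. P (fderiv J z0 v) = v"
    and k: "P k' = 0" "k \<bullet> k' \<noteq> 0" "\<And>q. P q = 0 \<Longrightarrow> k \<bullet> q = 0 \<Longrightarrow> q = 0"
    by simp_all
  have Pbl: "bounded_linear P" using P(1) by (simp add: linear_conv_bounded_linear)
  define \<Phi> where "\<Phi> z = P (J z)" for z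
  have \<Phi>Ck: "Ck_on m \<Phi> W" for m
    unfolding \<Phi>_def[abs_def] by (rule Ck_on_bounded_linear[OF Pbl assms(1) JCk])
  have "(\<Phi> has_derivative (\<lambda>v. P (fderiv J z0 v))) (at z0)"
    unfolding \<Phi>_def[abs_def] by (rule bounded_linear.has_derivative[OF Pbl J'[OF assms(3)]])
  from fun_cong[OF has_derivative_unique[OF fderiv_has_derivative[OF \<Phi>Ck assms(3)] this]]
  have "fderiv \<Phi> z0 v = v" for v by (simp add: P(2))
  then have "\<And>v. fderiv \<Phi> z0 v = 0 \<Longrightarrow> v = 0" by simp
  with smooth_inverse_function[OF assms(1) _ assms(3), of \<Phi>] \<Phi>Ck
  obtain U V \<Theta> where U: "open U" "U \<subseteq> W" "z0 \<in> U" and V: "open V"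
    and hom: "homeomorphism U V \<Phi> \<Theta>" and \<Theta>: "smooth_on \<Theta> V"
    unfolding smooth_on_def by metis
  have \<Theta>Ck: "Ck_on m \<Theta> V" for m using \<Theta> by (simp add: smooth_on_def)
  have \<Phi>U: "\<Phi> z \<in> V" and \<Theta>\<Phi>: "\<Theta> (\<Phi> z) = z" if "z \<in> U" for z
    using hom that by (auto simp: homeomorphism_def)
  have \<Theta>V: "\<Theta> y \<in> U" and \<Phi>\<Theta>: "\<Phi> (\<Theta> y) = y" if "y \<in> V" for y
    using hom that by (auto simp: homeomorphism_def)
  have J\<Theta>Ck: "Ck_on m (\<lambda>y. J (\<Theta> y)) V" for m
    by (rule Ck_on_compose[OF V \<Theta>Ck JCk]) (use \<Theta>V U(2) in blast)
  let ?Q = "P -` V"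
  have Q: "open ?Q"
    using continuous_open_vimage[OF V, of P] bounded_linear.isCont[OF Pbl continuous_ident] by blast
  have PCk: "Ck_on m P ?Q" for m by (rule Ck_on_linear[OF Pbl])
  have retract: "J (\<Theta> (P q)) = q" if "q \<in> J ` U" for q
    using that \<Theta>\<Phi> by (auto simp: \<Phi>_def)
  have QU: "J ` U \<subseteq> ?Q" using \<Phi>U by (auto simp: \<Phi>_def)
  \<comment> \<open>The height of \<open>q\<close> over its retraction, measured by
    \<open>k\<close>. On \<open>?Q\<close> the map \<open>P\<close> kills the difference of the two
    points, so the height vanishes exactly when they coincide.\<close>
  define N where "N q = k \<bullet> (q - J (\<Theta> (P q)))" for q
  have NCk: "Ck_on m N ?Q" for m
    unfolding N_def[abs_def]
    by (intro Ck_on_bounded_linear[OF bounded_linear_inner_right] Q Ck_on_diff Ck_on_ident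
        Ck_on_compose[OF Q PCk J\<Theta>Ck]) blast
  have N': "frechet_derivative N (at q) \<noteq> (\<lambda>v. 0)" if q: "q \<in> ?Q" for q
  proof -
    have Pq: "P q \<in> V" using q by simp
    have "(P has_derivative P) (at q)" by (rule bounded_linear_imp_has_derivative[OF Pbl])
    from has_derivative_compose[OF this fderiv_has_derivative[OF J\<Theta>Ck Pq]]
    have "((\<lambda>q. J (\<Theta> (P q))) has_derivative (\<lambda>v. fderiv (\<lambda>y. J (\<Theta> y)) (P q) (P v))) (at q)" .
    then have "(N has_derivative (\<lambda>v. k \<bullet> (v - fderiv (\<lambda>y. J (\<Theta> y)) (P q) (P v)))) (at q)"
      unfolding N_def[abs_def]
      by (intro has_derivative_inner_right has_derivative_diff has_derivative_ident)
    \<comment> \<open>In the direction \<open>k'\<close> the retraction does not move, since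
      \<open>P k' = 0\<close>; only the linear term is left.\<close>
    from fun_cong[OF frechet_derivative_at[OF this, symmetric], of k']
    have "frechet_derivative N (at q) k' = k \<bullet> k'" by (simp add: k(1))
    then show ?thesis using k(2) by auto
  qed
  have zero: "J ` U \<inter> ?Q = {q \<in> ?Q. N q = 0}"
  proof (intro set_eqI iffI)
    fix q assume "q \<in> J ` U \<inter> ?Q"
    then show "q \<in> {q \<in> ?Q. N q = 0}" using retract by (simp add: N_def)
  next
    fix q assume "q \<in> {q \<in> ?Q. N q = 0}"
    then have q: "P q \<in> V" "N q = 0" by auto
    have "P (q - J (\<Theta> (P q))) = P q - \<Phi> (\<Theta> (P q))"
      by (simp add: linear_diff[OF P(1)] \<Phi>_def)
    then have "q - J (\<Theta> (P q)) = 0"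
      using q \<Phi>\<Theta>[OF q(1)] by (intro k(3)) (simp_all add: N_def)
    then have "q = J (\<Theta> (P q))" by simp
    then show "q \<in> J ` U \<inter> ?Q" using \<Theta>V[OF q(1)] q(1) by blast
  qed
  have "hypersurface (J ` U)"
    unfolding hypersurface_def
  proof (rule ballI, rule exI[of _ ?Q], rule exI[of _ N], intro conjI ballI N' zero Q)
    show "q \<in> ?Q" if "q \<in> J ` U" for q using that QU by blast
    show "smooth_on N ?Q" using NCk by (simp add: smooth_on_def)
  qed
  moreover have "homeomorphism U (J ` U) J (\<lambda>q. \<Theta> (P q))"
  proof (rule homeomorphismI)
    show "continuous_on U J" by (rule continuous_on_subset[OF Ck_on_continuous[OF JCk] U(2)])
    show "continuous_on (J ` U) (\<lambda>q. \<Theta> (P q))"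
      using QU by (intro continuous_on_compose2[OF Ck_on_continuous[OF \<Theta>Ck]]
          bounded_linear.continuous_on[OF Pbl] continuous_on_id) auto
    show "(\<lambda>q. \<Theta> (P q)) ` J ` U \<subseteq> U" using QU \<Theta>V by blast
    show "\<Theta> (P (J z)) = z" if "z \<in> U" for z using \<Theta>\<Phi>[OF that] by (simp add: \<Phi>_def)
    show "J (\<Theta> (P q)) = q" if "q \<in> J ` U" for q using retract[OF that] .
  qed simp
  moreover have "tangent_space_of (J ` U) (J z) = range (blinfun_apply (fderiv J z))" if z: "z \<in> U" for z
  proof (intro set_eqI iffI)
    fix w assume "w \<in> tangent_space_of (J ` U) (J z)"
    then obtain e \<gamma> where e: "0 < e" and \<gamma>: "\<gamma> ` {-e<..<e} \<subseteq> J ` U" "\<gamma> 0 = J z"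
      and w: "(\<gamma> has_vector_derivative w) (at 0)"
      unfolding tangent_space_of_def by blast
    \<comment> \<open>The curve lies in the image, so it equals its own retraction; differentiating
      this identity exhibits \<open>w\<close> as a value of \<open>fderiv J z\<close>.\<close>
    have "((\<lambda>s. P (\<gamma> s)) has_derivative (\<lambda>s. P (s *\<^sub>R w))) (at 0)"
      by (rule bounded_linear.has_derivative[OF Pbl w[unfolded has_vector_derivative_def]])
    moreover have "(\<Theta> has_derivative fderiv \<Theta> (P (\<gamma> 0))) (at (P (\<gamma> 0)))"
      using \<Phi>U[OF z] by (intro fderiv_has_derivative[OF \<Theta>Ck]) (simp add: \<Phi>_def \<gamma>(2))
    ultimately have "((\<lambda>s. \<Theta> (P (\<gamma> s))) has_derivative (\<lambda>s. fderiv \<Theta> (P (\<gamma> 0)) (P (s *\<^sub>R w)))) (at 0)"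
      by (rule has_derivative_compose)
    moreover have "\<Theta> (P (\<gamma> 0)) = z" using \<Theta>\<Phi>[OF z] by (simp add: \<Phi>_def \<gamma>(2))
    then have "(J has_derivative fderiv J z) (at (\<Theta> (P (\<gamma> 0))))" using J' z U(2) by auto
    ultimately have "((\<lambda>s. J (\<Theta> (P (\<gamma> s)))) has_derivative
        (\<lambda>s. fderiv J z (fderiv \<Theta> (P (\<gamma> 0)) (P (s *\<^sub>R w))))) (at 0)"
      by (rule has_derivative_compose)
    then have d: "(\<gamma> has_derivative (\<lambda>s. fderiv J z (fderiv \<Theta> (P (\<gamma> 0)) (P (s *\<^sub>R w))))) (at 0)"
    proof (rule has_derivative_transform_within_open)
      show "J (\<Theta> (P (\<gamma> s))) = \<gamma> s" if "s \<in> {-e<..<e}" for s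
        using retract that \<gamma>(1) by blast
    qed (use e in auto)
    from fun_cong[OF has_derivative_unique[OF w[unfolded has_vector_derivative_def] d], of 1]
    show "w \<in> range (blinfun_apply (fderiv J z))" by simp
  next
    fix w assume "w \<in> range (blinfun_apply (fderiv J z))"
    then obtain v where w: "w = fderiv J z v" by blast
    define \<gamma> where "\<gamma> s = J (z + s *\<^sub>R v)" for s :: real
    have lineCk: "Ck_on m (\<lambda>s. z + s *\<^sub>R v) T" if "open T" for m and T :: "real set"
      by (intro Ck_on_add Ck_on_scaleR Ck_on_const Ck_on_ident that)
    have "open ((\<lambda>s::real. z + s *\<^sub>R v) -` U)"
      by (intro continuous_open_vimage U(1)) (intro continuous_intros)
    moreover have "0 \<in> (\<lambda>s::real. z + s *\<^sub>R v) -` U" using z by simp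
    ultimately obtain e where e: "0 < e" "ball 0 e \<subseteq> (\<lambda>s::real. z + s *\<^sub>R v) -` U"
      by (meson open_contains_ball)
    then have sU: "z + s *\<^sub>R v \<in> U" if "s \<in> {-e<..<e}" for s
      using that by (auto simp: subset_iff dist_norm)
    have "smooth_on \<gamma> {-e<..<e}"
      unfolding smooth_on_def \<gamma>_def[abs_def]
      by (intro allI Ck_on_compose[OF _ lineCk JCk]) (use sU U(2) in auto)
    moreover have "\<gamma> ` {-e<..<e} \<subseteq> J ` U" using sU by (auto simp: \<gamma>_def)
    moreover have "(\<gamma> has_vector_derivative w) (at 0)"
    proof -
      have "((\<lambda>s. z + s *\<^sub>R v) has_derivative (\<lambda>s. s *\<^sub>R v)) (at 0)"
        by (auto intro!: derivative_eq_intros)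
      moreover have "(J has_derivative fderiv J z) (at (z + 0 *\<^sub>R v))" using J' z U(2) by auto
      ultimately have "((\<lambda>s. J (z + s *\<^sub>R v)) has_derivative (\<lambda>s. fderiv J z (s *\<^sub>R v))) (at 0)"
        by (rule has_derivative_compose)
      then show ?thesis
        unfolding has_vector_derivative_def \<gamma>_def[abs_def] w by (simp only: blinfun.scaleR_right)
    qed
    ultimately show "w \<in> tangent_space_of (J ` U) (J z)"
      unfolding tangent_space_of_def using e(1)
      by (intro CollectI exI[of _ e] conjI exI[of _ \<gamma>]) (simp_all add: \<gamma>_def)
  qed
  ultimately show ?thesis
    using U by (intro exI[of _ U] exI[of _ "\<lambda>q. \<Theta> (P q)"]) simp
qed


section \<open>The embedding\<close>

lemma local_para_CR_embedding:
  fixes F G :: "real ^ 3 \<Rightarrow> real ^ 3"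
  assumes X: "open X" "z0 \<in> X" and F: "smooth_on F X" and G: "smooth_on G X"
    and nz: "\<And>z. z \<in> X \<Longrightarrow> F z \<noteq> 0" "\<And>z. z \<in> X \<Longrightarrow> G z \<noteq> 0"
    and indep: "\<And>z s t. z \<in> X \<Longrightarrow> s *\<^sub>R F z = t *\<^sub>R G z \<Longrightarrow> s *\<^sub>R F z = 0"
  shows "\<exists>U (J :: real ^ 3 \<Rightarrow> (real ^ 2) \<times> (real ^ 2)) h.
    open U \<and> z0 \<in> U \<and> U \<subseteq> X \<and> smooth_on J U \<and> homeomorphism U (J ` U) J h \<and>
    has_induced_para_CR (J ` U) \<and>
    (\<forall>z\<in>U. (\<forall>v. fderiv J z v = 0 \<longrightarrow> v = 0) \<and>
      induced_xy (J ` U) (J z) = range (\<lambda>t. fderiv J z (t *\<^sub>R F z)) \<and>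
      induced_ab (J ` U) (J z) = range (\<lambda>t. fderiv J z (t *\<^sub>R G z)))"
proof -
  obtain Nf and f :: "real ^ 3 \<Rightarrow> real ^ 2" where Nf: "open Nf" "z0 \<in> Nf" "Nf \<subseteq> X" "smooth_on f Nf"
    and f: "\<forall>z\<in>Nf. \<forall>v. fderiv f z v = 0 \<longleftrightarrow> (\<exists>t. v = t *\<^sub>R F z)"
    using first_integrals[OF X(1) F X(2) nz(1)[OF X(2)]] by (elim exE conjE)
  obtain Ng and g :: "real ^ 3 \<Rightarrow> real ^ 2" where Ng: "open Ng" "z0 \<in> Ng" "Ng \<subseteq> X" "smooth_on g Ng"
    and g: "\<forall>z\<in>Ng. \<forall>v. fderiv g z v = 0 \<longleftrightarrow> (\<exists>t. v = t *\<^sub>R G z)"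
    using first_integrals[OF X(1) G X(2) nz(2)[OF X(2)]] by (elim exE conjE)
  define N where "N = Nf \<inter> Ng"
  have N: "open N" "z0 \<in> N" "N \<subseteq> X" "N \<subseteq> Nf" "N \<subseteq> Ng" using Nf Ng by (auto simp: N_def)
  have fCk: "Ck_on k f N" and gCk: "Ck_on k g N" for k
    using Nf(4) Ng(4) Ck_on_subset N(4,5) unfolding smooth_on_def by blast+
  define J where "J z = (g z, f z)" for z
  have JCk: "Ck_on k J N" for k
    unfolding J_def[abs_def] by (rule Ck_on_Pair[OF N(1) gCk fCk])
  have J': "fderiv J z v = (fderiv g z v, fderiv f z v)" if z: "z \<in> N" for z v
  proof -
    have "(J has_derivative (\<lambda>v. (fderiv g z v, fderiv f z v))) (at z)"
      unfolding J_def[abs_def]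
      by (rule has_derivative_Pair[OF fderiv_has_derivative[OF gCk z] fderiv_has_derivative[OF fCk z]])
    from fun_cong[OF has_derivative_unique[OF fderiv_has_derivative[OF JCk z] this]]
    show ?thesis .
  qed
  have inj: "v = 0" if z: "z \<in> N" and v: "fderiv J z v = 0" for z v
  proof -
    have "fderiv f z v = 0" "fderiv g z v = 0" using v J'[OF z] by (simp_all add: zero_prod_def)
    then obtain s t where "v = s *\<^sub>R F z" "v = t *\<^sub>R G z" using f g z N(4,5) by blast
    then show "v = 0" using indep[of z s t] z N(3) by auto
  qed
  have "smooth_on J N" using JCk by (simp add: smooth_on_def)
  from parametrised_hypersurface[OF N(1) this N(2) _ inj[OF N(2)]]
  obtain U h where U: "open U" "z0 \<in> U" "U \<subseteq> N" "homeomorphism U (J ` U) J h" "hypersurface (J ` U)"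
    and tan: "\<forall>z\<in>U. tangent_space_of (J ` U) (J z) = range (blinfun_apply (fderiv J z))"
    by auto
  have xy: "induced_xy (J ` U) (J z) = range (\<lambda>t. fderiv J z (t *\<^sub>R F z))" if z: "z \<in> U" for z
  proof -
    have zN: "z \<in> N" using z U(3) by blast
    \<comment> \<open>The second component of \<open>fderiv J z v\<close> is
      \<open>fderiv f z v\<close>, so lying in \<open>T_xy\<close> means that \<open>v\<close> is in
      the kernel of \<open>fderiv f z\<close>, the line of \<open>F z\<close>.\<close>
    have "range (blinfun_apply (fderiv J z)) \<inter> T_xy = fderiv J z ` {v. fderiv f z v = 0}"
      by (auto simp: T_xy_def J'[OF zN])
    also have "{v. fderiv f z v = 0} = range (\<lambda>t. t *\<^sub>R F z)"
      using f zN N(4) by blast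
    finally show ?thesis using tan z by (simp add: induced_xy_def image_image)
  qed
  have ab: "induced_ab (J ` U) (J z) = range (\<lambda>t. fderiv J z (t *\<^sub>R G z))" if z: "z \<in> U" for z
  proof -
    have zN: "z \<in> N" using z U(3) by blast
    have "range (blinfun_apply (fderiv J z)) \<inter> T_ab = fderiv J z ` {v. fderiv g z v = 0}"
      by (auto simp: T_ab_def J'[OF zN])
    also have "{v. fderiv g z v = 0} = range (\<lambda>t. t *\<^sub>R G z)"
      using g zN N(5) by blast
    finally show ?thesis using tan z by (simp add: induced_ab_def image_image)
  qed
  have dim1: "dim (range (\<lambda>t. fderiv J z (t *\<^sub>R v))) = 1" if z: "z \<in> U" and v: "v \<noteq> 0" for z v
  proof -
    have "range (\<lambda>t. fderiv J z (t *\<^sub>R v)) = span {fderiv J z v}"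
      by (simp add: span_singleton blinfun.scaleR_right)
    moreover have "fderiv J z v \<noteq> 0" using inj z U(3) v by blast
    ultimately show ?thesis by (simp add: dim_span)
  qed
  have "has_induced_para_CR (J ` U)"
    unfolding has_induced_para_CR_def
  proof (intro conjI ballI U(5))
    fix q assume "q \<in> J ` U"
    then obtain z where q: "q = J z" and z: "z \<in> U" by blast
    have "z \<in> X" using z U(3) N(3) by blast
    then show "dim (induced_xy (J ` U) q) = 1" "dim (induced_ab (J ` U) q) = 1"
      unfolding q xy[OF z] ab[OF z] by (intro dim1[OF z] nz; assumption)+
  qed
  moreover have "smooth_on J U"
    using Ck_on_subset[OF JCk U(3)] by (simp add: smooth_on_def)
  moreover have "\<forall>z\<in>U. (\<forall>v. fderiv J z v = 0 \<longrightarrow> v = 0) \<and>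
      induced_xy (J ` U) (J z) = range (\<lambda>t. fderiv J z (t *\<^sub>R F z)) \<and>
      induced_ab (J ` U) (J z) = range (\<lambda>t. fderiv J z (t *\<^sub>R G z))"
    using inj U(3) xy ab by blast
  moreover have "U \<subseteq> X" using U(3) N(3) by blast
  ultimately show ?thesis using U(1,2,4)
    by (intro exI[of _ U] exI[of _ J] exI[of _ h] conjI)
qed

section \<open>Charts as homeomorphisms\<close>

lemma chart_inv_apply: "is_chart M c \<Longrightarrow> q \<in> fst c \<Longrightarrow> chart_inv c (snd c q) = q"
proof -
  assume c: "is_chart M c" "q \<in> fst c"
  then have "homeomorphic_map (subtopology M (fst c))
      (subtopology euclidean (snd c ` topspace (subtopology M (fst c)))) (snd c)"
    by (simp add: is_chart_def embedding_map_def)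
  moreover have "topspace (subtopology M (fst c)) = fst c"
    using c openin_subset by (auto simp: is_chart_def)
  ultimately have "inj_on (snd c) (fst c)"
    using homeomorphic_imp_injective_map by metis
  then show ?thesis using c(2) by (simp add: chart_inv_def)
qed

lemma chart_homeomorphic_map:
  assumes "is_chart M c"
  shows "homeomorphic_map (subtopology M (fst c)) (top_of_set (snd c ` fst c)) (snd c)"
proof -
  have "topspace (subtopology M (fst c)) = fst c"
    using assms openin_subset by (auto simp: is_chart_def)
  then show ?thesis using assms by (simp add: is_chart_def embedding_map_def)
qed

lemma chart_open_image:
  assumes c: "is_chart M c" and "openin M V" "V \<subseteq> fst c"
  shows "open (snd c ` V)"
proof -
  have "openin (subtopology M (fst c)) V"
    using assms by (simp add: openin_open_subtopology is_chart_def)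
  then have "openin (top_of_set (snd c ` fst c)) (snd c ` V)"
    using homeomorphic_imp_open_map[OF chart_homeomorphic_map[OF c]] by (simp add: open_map_def)
  moreover have "open (snd c ` fst c)" using c by (simp add: is_chart_def)
  ultimately show ?thesis using openin_open_trans by blast
qed

lemma chart_open_preimage:
  assumes c: "is_chart M c" and "open W"
  shows "openin M {q \<in> fst c. snd c q \<in> W}"
proof -
  have top: "topspace (subtopology M (fst c)) = fst c"
    using c openin_subset by (auto simp: is_chart_def)
  have "continuous_map (subtopology M (fst c)) euclidean (snd c)"
    using homeomorphic_imp_continuous_map[OF chart_homeomorphic_map[OF c]]
    by (rule continuous_map_into_fulltopology)
  from openin_continuous_map_preimage[OF this, of W]
  have "openin (subtopology M (fst c)) {q \<in> fst c. snd c q \<in> W}"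
    unfolding top using assms(2) by simp
  then show ?thesis using c by (simp add: openin_open_subtopology is_chart_def)
qed

section \<open>Tangent vectors and differentials read in a chart\<close>

context
  fixes M :: "'a topology" and A :: "('a, 'n::finite) chart set"
  assumes M: "smooth_manifold M A"
begin

lemma atlas_chart: "c \<in> A \<Longrightarrow> is_chart M c"
  using M by (simp add: smooth_manifold_def)

lemma transition_Ck:
  "c \<in> A \<Longrightarrow> d \<in> A \<Longrightarrow> Ck_on k (snd d \<circ> chart_inv c) (snd c ` (fst c \<inter> fst d))"
  using M by (simp add: smooth_manifold_def smooth_on_def)

lemma transition_differentiable:
  assumes "c \<in> A" "d \<in> A" "q \<in> fst c" "q \<in> fst d"
  shows "(snd d \<circ> chart_inv c) differentiable (at (snd c q))"
  using transition_Ck[OF assms(1,2), of "Suc 0"] assms(3,4) by simp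

lemma tangent_space_transition:
  assumes "v \<in> tangent_space A q" "c \<in> A" "d \<in> A" "q \<in> fst c" "q \<in> fst d"
  shows "v d = frechet_derivative (snd d \<circ> chart_inv c) (at (snd c q)) (v c)"
  using assms unfolding tangent_space_def by blast

lemma tangent_space_outside:
  assumes "v \<in> tangent_space A q" "\<not> (c \<in> A \<and> q \<in> fst c)"
  shows "v c = 0"
  using assms unfolding tangent_space_def by blast

text \<open>The coordinates in one chart determine those in every chart around \<open>q\<close> by
  the transition formula, and the value 0 prescribed on all other charts settles equality as
  functions.\<close>

lemma tangent_space_eqI:
  assumes "v \<in> tangent_space A q" "w \<in> tangent_space A q" "c \<in> A" "q \<in> fst c" "v c = w c"
  shows "v = w"
proof
  fix d
  show "v d = w d"
  proof (cases "d \<in> A \<and> q \<in> fst d")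
    case True
    then show ?thesis
      using tangent_space_transition[OF assms(1,3) _ assms(4), of d]
        tangent_space_transition[OF assms(2,3) _ assms(4), of d] assms(5) by metis
  next
    case False
    then show ?thesis
      using tangent_space_outside[OF assms(1)] tangent_space_outside[OF assms(2)] by metis
  qed
qed

lemma tangent_space_scaleR:
  assumes "v \<in> tangent_space A q"
  shows "(\<lambda>c. t *\<^sub>R v c) \<in> tangent_space A q"
  unfolding tangent_space_def
proof (intro CollectI conjI ballI allI impI)
  fix c d assume cd: "c \<in> A" "d \<in> A" "q \<in> fst c \<and> q \<in> fst d"
  then have cd': "c \<in> A" "d \<in> A" "q \<in> fst c" "q \<in> fst d" by auto
  show "t *\<^sub>R v d = frechet_derivative (snd d \<circ> chart_inv c) (at (snd c q)) (t *\<^sub>R v c)"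
    unfolding linear_cmul[OF linear_frechet_derivative[OF transition_differentiable[OF cd']]]
    by (rule arg_cong[OF tangent_space_transition[OF assms cd']])
next
  fix c assume "\<not> (c \<in> A \<and> q \<in> fst c)"
  then show "t *\<^sub>R v c = 0" using tangent_space_outside[OF assms] by simp
qed

text \<open>\<open>differential\<close> works in a chart picked by \<open>SOME\<close>. The chain
  rule through the transition map to \<open>c\<close> and the transformation law of \<open>v\<close>
  make that choice cancel.\<close>

lemma differential_chart:
  assumes c: "c \<in> A" "q \<in> fst c" and v: "v \<in> tangent_space A q"
    and f: "f differentiable (at (snd c q))"
  shows "differential A (f \<circ> snd c) q v = frechet_derivative f (at (snd c q)) (v c)"
proof -
  define d where "d = (SOME c. c \<in> A \<and> q \<in> fst c)"
  have d: "d \<in> A" "q \<in> fst d"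
    using someI[of "\<lambda>c. c \<in> A \<and> q \<in> fst c" c] c by (simp_all add: d_def)
  have eq: "(snd c \<circ> chart_inv d) (snd d q) = snd c q"
    using chart_inv_apply[OF atlas_chart[OF d(1)] d(2)] by simp
  have "differential A (f \<circ> snd c) q v =
      frechet_derivative (f \<circ> (snd c \<circ> chart_inv d)) (at (snd d q)) (v d)"
    by (simp add: differential_def Let_def d_def[symmetric] o_assoc)
  also have "\<dots> = (frechet_derivative f (at ((snd c \<circ> chart_inv d) (snd d q))) \<circ>
      frechet_derivative (snd c \<circ> chart_inv d) (at (snd d q))) (v d)"
    using f by (subst frechet_derivative_compose[OF transition_differentiable[OF d(1) c(1) d(2) c(2)]])
      (simp_all only: eq)
  also have "\<dots> = frechet_derivative f (at (snd c q)) (v c)"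
    unfolding eq by (simp add: tangent_space_transition[OF v d(1) c(1) d(2) c(2), symmetric])
  finally show ?thesis .
qed

text \<open>Carries an embedding of an open coordinate set over to the manifold. Smoothness in
  another chart \<open>d\<close> follows through the transition map to \<open>c\<close>, and
  differentials stay injective because \<open>v c\<close> determines \<open>v\<close>.\<close>

lemma embedding_through_chart:
  fixes J :: "real ^ 'n \<Rightarrow> 'b::euclidean_space"
  assumes c: "c \<in> A" and W: "open W" "W \<subseteq> snd c ` fst c" and J: "smooth_on J W"
    and hom: "homeomorphism W (J ` W) J h"
    and inj: "\<And>z v. z \<in> W \<Longrightarrow> fderiv J z v = 0 \<Longrightarrow> v = 0"
  defines "U \<equiv> {q \<in> fst c. snd c q \<in> W}"
  shows "smooth_embedding_on M A U (J \<circ> snd c)"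
    and "q \<in> U \<Longrightarrow> v \<in> tangent_space A q \<Longrightarrow> differential A (J \<circ> snd c) q v = fderiv J (snd c q) (v c)"
proof -
  have JCk: "Ck_on k J W" for k using J by (simp add: smooth_on_def)
  have Jd: "J differentiable (at z)" if "z \<in> W" for z
    using JCk[of "Suc 0"] that by simp
  have U: "openin M U" unfolding U_def by (rule chart_open_preimage[OF atlas_chart[OF c] W(1)])
  have Uc: "U \<subseteq> fst c" by (auto simp: U_def)
  have UW: "snd c ` U = W" using W(2) by (auto simp: U_def)
  have diff: "differential A (J \<circ> snd c) q v = fderiv J (snd c q) (v c)"
    if "q \<in> U" "v \<in> tangent_space A q" for q v
    using differential_chart[OF c _ that(2) Jd] that(1) by (simp add: U_def fderiv_apply Jd)
  then show "q \<in> U \<Longrightarrow> v \<in> tangent_space A q \<Longrightarrow>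
      differential A (J \<circ> snd c) q v = fderiv J (snd c q) (v c)" .
  show "smooth_embedding_on M A U (J \<circ> snd c)"
    unfolding smooth_embedding_on_def
  proof (intro conjI ballI)
    show "smooth_map_on A U (J \<circ> snd c)"
      unfolding smooth_map_on_def smooth_on_def
    proof (intro ballI allI)
      fix d k assume d: "d \<in> A"
      let ?S = "snd d ` (U \<inter> fst d)"
      have "openin M (U \<inter> fst d)"
        using U atlas_chart[OF d] by (auto simp: is_chart_def)
      then have S: "open ?S" by (intro chart_open_image[OF atlas_chart[OF d]]) auto
      have "Ck_on k (snd c \<circ> chart_inv d) ?S"
        by (rule Ck_on_subset[OF transition_Ck[OF d c]]) (use Uc in blast)
      moreover have "(snd c \<circ> chart_inv d) ` ?S \<subseteq> W"
        using chart_inv_apply[OF atlas_chart[OF d]] by (auto simp: U_def)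
      ultimately show "Ck_on k (J \<circ> snd c \<circ> chart_inv d) ?S"
        using Ck_on_compose[OF S _ JCk, of k "snd c \<circ> chart_inv d"] by (simp add: o_def)
    qed
  next
    fix q assume q: "q \<in> U"
    show "inj_on (differential A (J \<circ> snd c) q) (tangent_space A q)"
    proof (rule inj_onI)
      fix v w assume v: "v \<in> tangent_space A q" and w: "w \<in> tangent_space A q"
        and "differential A (J \<circ> snd c) q v = differential A (J \<circ> snd c) q w"
      then have "fderiv J (snd c q) (v c - w c) = 0"
        using diff[OF q v] diff[OF q w] by (simp add: blinfun.diff_right)
      then have "v c - w c = 0" using q by (intro inj) (simp_all add: U_def)
      then show "v = w" using q by (intro tangent_space_eqI[OF v w c]) (simp_all add: U_def)
    qed
  next
    \<comment> \<open>The map is a composition of two homeomorphisms, the chart restricted to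
      \<open>U\<close> and \<open>J\<close> on \<open>W\<close>.\<close>
    have "homeomorphic_map (subtopology (subtopology M (fst c)) U)
        (subtopology (top_of_set (snd c ` fst c)) W) (snd c)"
    proof (rule homeomorphic_map_subtopologies[OF chart_homeomorphic_map[OF atlas_chart[OF c]]])
      show "snd c ` (topspace (subtopology M (fst c)) \<inter> U) = topspace (top_of_set (snd c ` fst c)) \<inter> W"
        using UW W(2) Uc openin_subset[OF U] by (auto simp: Int_absorb1)
    qed
    moreover have "subtopology (subtopology M (fst c)) U = subtopology M U"
      using Uc by (simp add: subtopology_subtopology Int_absorb1)
    moreover have "subtopology (top_of_set (snd c ` fst c)) W = top_of_set W"
      using W(2) by (simp add: subtopology_subtopology Int_absorb1)
    ultimately have 1: "homeomorphic_map (subtopology M U) (top_of_set W) (snd c)" by simp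
    have "homeomorphic_maps (top_of_set W) (top_of_set (J ` W)) J h"
      using hom by (auto simp: homeomorphic_maps_def homeomorphism_def)
    then have 2: "homeomorphic_map (top_of_set W) (top_of_set (J ` W)) J"
      using homeomorphic_map_maps by blast
    have "(J \<circ> snd c) ` topspace (subtopology M U) = J ` W"
      using openin_subset[OF U] by (simp add: Int_absorb1 flip: UW) (simp add: image_image)
    then show "embedding_map (subtopology M U) euclidean (J \<circ> snd c)"
      using homeomorphic_map_compose[OF 1 2] by (simp add: embedding_map_def)
  qed
qed

end

text \<open>A tangent vector is determined by its value at the single chart \<open>c\<close>. Hence
  non-vanishing and independence of the two fields, which are stated for families over all charts,
  pass to coordinate vectors in \<open>real ^ 3\<close>.\<close>

lemma para_CR_chart_fields:
  fixes M :: "'a topology" and A :: "('a, 3) chart set"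
  assumes M: "smooth_manifold M A" and XY: "para_CR M A X Y" and p: "p \<in> topspace M"
  shows "\<exists>c U0 X1 Y1. c \<in> A \<and> openin M U0 \<and> U0 \<subseteq> fst c \<and> p \<in> U0 \<and>
    smooth_on (\<lambda>z. X1 (chart_inv c z) c) (snd c ` U0) \<and>
    smooth_on (\<lambda>z. Y1 (chart_inv c z) c) (snd c ` U0) \<and>
    (\<forall>q\<in>U0. X1 q \<in> tangent_space A q \<and> Y1 q \<in> tangent_space A q \<and>
      X q = tangent_line (X1 q) \<and> Y q = tangent_line (Y1 q) \<and> X1 q c \<noteq> 0 \<and> Y1 q c \<noteq> 0 \<and>
      (\<forall>s t. s *\<^sub>R X1 q c = t *\<^sub>R Y1 q c \<longrightarrow> s *\<^sub>R X1 q c = 0))"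
proof -
  have "(\<Union>c\<in>A. fst c) = topspace M" using M by (simp add: smooth_manifold_def)
  then obtain c where c: "c \<in> A" "p \<in> fst c" using p by blast
  obtain U1 X1 where U1: "openin M U1" "p \<in> U1" "smooth_vector_field_on A U1 X1"
    and X1: "\<forall>q\<in>U1. X1 q \<noteq> (\<lambda>c. 0) \<and> X q = tangent_line (X1 q)"
    using XY p unfolding para_CR_def direction_field_def by blast
  obtain U2 Y1 where U2: "openin M U2" "p \<in> U2" "smooth_vector_field_on A U2 Y1"
    and Y1: "\<forall>q\<in>U2. Y1 q \<noteq> (\<lambda>c. 0) \<and> Y q = tangent_line (Y1 q)"
    using XY p unfolding para_CR_def direction_field_def by blast
  define U0 where "U0 = U1 \<inter> U2 \<inter> fst c"
  have U0: "openin M U0"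
    using U1(1) U2(1) atlas_chart[OF M c(1)] by (auto simp: U0_def is_chart_def)
  have tX: "X1 q \<in> tangent_space A q" and tY: "Y1 q \<in> tangent_space A q" if "q \<in> U0" for q
    using that U1(3) U2(3) by (auto simp: U0_def smooth_vector_field_on_def)
  have nz: "v c \<noteq> 0" if "v \<in> tangent_space A q" "q \<in> U0" "v \<noteq> (\<lambda>c. 0)" for v q
  proof
    assume "v c = 0"
    moreover have "(\<lambda>c. 0) \<in> tangent_space A q"
      using tangent_space_scaleR[OF M that(1), of 0] by simp
    ultimately show False
      using tangent_space_eqI[OF M that(1) _ c(1)] that(2,3) by (auto simp: U0_def)
  qed
  have ind: "s *\<^sub>R X1 q c = 0" if q: "q \<in> U0" and eq: "s *\<^sub>R X1 q c = t *\<^sub>R Y1 q c" for q s t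
  proof -
    have "(\<lambda>c. s *\<^sub>R X1 q c) = (\<lambda>c. t *\<^sub>R Y1 q c)"
      by (rule tangent_space_eqI[OF M tangent_space_scaleR[OF M tX[OF q]]
            tangent_space_scaleR[OF M tY[OF q]] c(1)])
        (use q eq in \<open>simp_all add: U0_def\<close>)
    moreover have "(\<lambda>c. s *\<^sub>R v c) \<in> tangent_line v" for v :: "('a, 3) tangent_vector" and s
      unfolding tangent_line_def by (rule rangeI)
    moreover have "X q = tangent_line (X1 q)" "Y q = tangent_line (Y1 q)"
      using X1 Y1 q by (simp_all add: U0_def)
    ultimately have "(\<lambda>c. s *\<^sub>R X1 q c) \<in> X q \<inter> Y q" by (metis IntI)
    moreover have "X q \<inter> Y q = {\<lambda>c. 0}"
      using XY q openin_subset[OF U0] by (auto simp: para_CR_def)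
    ultimately have "(\<lambda>c. s *\<^sub>R X1 q c) = (\<lambda>c. 0)" by simp
    from fun_cong[OF this, of c] show ?thesis .
  qed
  have sub: "snd c ` U0 \<subseteq> snd c ` (U1 \<inter> fst c)" "snd c ` U0 \<subseteq> snd c ` (U2 \<inter> fst c)"
    by (auto simp: U0_def)
  have "smooth_on (\<lambda>z. X1 (chart_inv c z) c) (snd c ` U0)"
    "smooth_on (\<lambda>z. Y1 (chart_inv c z) c) (snd c ` U0)"
    using U1(3) U2(3) c(1) Ck_on_subset[OF _ sub(1)] Ck_on_subset[OF _ sub(2)]
    unfolding smooth_vector_field_on_def smooth_on_def by blast+
  moreover have "\<forall>q\<in>U0. X1 q \<in> tangent_space A q \<and> Y1 q \<in> tangent_space A q \<and>
      X q = tangent_line (X1 q) \<and> Y q = tangent_line (Y1 q) \<and> X1 q c \<noteq> 0 \<and> Y1 q c \<noteq> 0 \<and>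
      (\<forall>s t. s *\<^sub>R X1 q c = t *\<^sub>R Y1 q c \<longrightarrow> s *\<^sub>R X1 q c = 0)"
    using tX tY X1 Y1 nz[OF tX] nz[OF tY] ind by (auto simp: U0_def)
  moreover have "p \<in> U0" "U0 \<subseteq> fst c" using U1(2) U2(2) c(2) by (auto simp: U0_def)
  ultimately show ?thesis using c(1) U0
    by (intro exI[of _ c] exI[of _ U0] exI[of _ X1] exI[of _ Y1] conjI)
qed

theorem proposition1:
  fixes M :: "'a topology" and A :: "('a, 3) chart set"
    and X Y :: "'a \<Rightarrow> ('a, 3) tangent_vector set"
  assumes "smooth_manifold M A"
    and "para_CR M A X Y"
  shows "\<forall>p\<in>topspace M. \<exists>U (\<iota> :: 'a \<Rightarrow> (real ^ 2) \<times> (real ^ 2)).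
    openin M U \<and> p \<in> U \<and>
    smooth_embedding_on M A U \<iota> \<and>
    has_induced_para_CR (\<iota> ` U) \<and>
    (\<forall>q\<in>U. differential A \<iota> q ` X q = induced_xy (\<iota> ` U) (\<iota> q) \<and>
           differential A \<iota> q ` Y q = induced_ab (\<iota> ` U) (\<iota> q))"
proof
  fix p assume p: "p \<in> topspace M"
  obtain c U0 X1 Y1 where c: "c \<in> A" and U0: "openin M U0" "U0 \<subseteq> fst c" "p \<in> U0"
    and smooth: "smooth_on (\<lambda>z. X1 (chart_inv c z) c) (snd c ` U0)"
      "smooth_on (\<lambda>z. Y1 (chart_inv c z) c) (snd c ` U0)"
    and XY: "\<forall>q\<in>U0. X1 q \<in> tangent_space A q \<and> Y1 q \<in> tangent_space A q \<and>
      X q = tangent_line (X1 q) \<and> Y q = tangent_line (Y1 q) \<and> X1 q c \<noteq> 0 \<and> Y1 q c \<noteq> 0 \<and>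
      (\<forall>s t. s *\<^sub>R X1 q c = t *\<^sub>R Y1 q c \<longrightarrow> s *\<^sub>R X1 q c = 0)"
    using para_CR_chart_fields[OF assms p] by (elim exE conjE)
  note chart = atlas_chart[OF assms(1) c]
  have inv: "chart_inv c (snd c q) = q" if "q \<in> U0" for q
    using chart_inv_apply[OF chart] that U0(2) by blast
  \<comment> \<open>The problem in coordinates: \<open>X1\<close> and \<open>Y1\<close>, read in the
    chart \<open>c\<close>, are vector fields on an open subset of \<open>real ^ 3\<close>.\<close>
  have "\<exists>W (J :: real ^ 3 \<Rightarrow> (real ^ 2) \<times> (real ^ 2)) h.
    open W \<and> snd c p \<in> W \<and> W \<subseteq> snd c ` U0 \<and> smooth_on J W \<and> homeomorphism W (J ` W) J h \<and>
    has_induced_para_CR (J ` W) \<and>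
    (\<forall>z\<in>W. (\<forall>v. fderiv J z v = 0 \<longrightarrow> v = 0) \<and>
      induced_xy (J ` W) (J z) = range (\<lambda>t. fderiv J z (t *\<^sub>R X1 (chart_inv c z) c)) \<and>
      induced_ab (J ` W) (J z) = range (\<lambda>t. fderiv J z (t *\<^sub>R Y1 (chart_inv c z) c)))"
    by (rule local_para_CR_embedding[OF chart_open_image[OF chart U0(1,2)] _ smooth])
      (use U0(3) XY inv in auto)
  then obtain W and J :: "real ^ 3 \<Rightarrow> (real ^ 2) \<times> (real ^ 2)" and h
    where W: "open W" "snd c p \<in> W" "W \<subseteq> snd c ` U0" and J: "smooth_on J W" "homeomorphism W (J ` W) J h"
    and CR: "has_induced_para_CR (J ` W)"
    and ind: "\<forall>z\<in>W. (\<forall>v. fderiv J z v = 0 \<longrightarrow> v = 0) \<and>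
      induced_xy (J ` W) (J z) = range (\<lambda>t. fderiv J z (t *\<^sub>R X1 (chart_inv c z) c)) \<and>
      induced_ab (J ` W) (J z) = range (\<lambda>t. fderiv J z (t *\<^sub>R Y1 (chart_inv c z) c))"
    by (elim exE conjE)
  define U where "U = {q \<in> fst c. snd c q \<in> W}"
  have Wc: "W \<subseteq> snd c ` fst c" using W(3) U0(2) by blast
  have inj: "v = 0" if "z \<in> W" "fderiv J z v = 0" for z v using ind that by blast
  have emb: "smooth_embedding_on M A U (J \<circ> snd c)"
    unfolding U_def by (rule embedding_through_chart(1)[OF assms(1) c W(1) Wc J inj])
  have diff: "differential A (J \<circ> snd c) q v = fderiv J (snd c q) (v c)"
    if "q \<in> U" "v \<in> tangent_space A q" for q v
    by (rule embedding_through_chart(2)[OF assms(1) c W(1) Wc J inj that(1)[unfolded U_def] that(2)])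
  \<comment> \<open>\<open>U\<close> is cut out by \<open>W\<close> alone; injectivity of the chart
    brings its points back into \<open>U0\<close>, where \<open>X1\<close> and \<open>Y1\<close>
    span the two direction fields.\<close>
  have UU0: "U \<subseteq> U0"
  proof
    fix q assume "q \<in> U"
    then have q: "q \<in> fst c" "snd c q \<in> snd c ` U0" using subsetD[OF W(3)] by (simp_all add: U_def)
    from q(2) obtain q' where q': "snd c q = snd c q'" "q' \<in> U0" by (rule imageE)
    have "q = q'" using chart_inv_apply[OF chart q(1)] inv[OF q'(2)] q'(1) by metis
    then show "q \<in> U0" using q'(2) by simp
  qed
  have im: "(J \<circ> snd c) ` U = J ` W"
    using Wc by (auto simp: U_def image_iff)
  \<comment> \<open>\<open>diff\<close> is available for tangent vectors, and the multiples of
    \<open>v\<close> that form its line are tangent vectors again.\<close>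
  have line: "differential A (J \<circ> snd c) q ` tangent_line v = range (\<lambda>t. fderiv J (snd c q) (t *\<^sub>R v c))"
    if "q \<in> U" "v \<in> tangent_space A q" for q v
    using diff[OF that(1) tangent_space_scaleR[OF assms(1) that(2)]]
    by (simp add: tangent_line_def image_image)
  have "differential A (J \<circ> snd c) q ` X q = induced_xy ((J \<circ> snd c) ` U) ((J \<circ> snd c) q) \<and>
      differential A (J \<circ> snd c) q ` Y q = induced_ab ((J \<circ> snd c) ` U) ((J \<circ> snd c) q)"
    if q: "q \<in> U" for q
  proof -
    have q0: "q \<in> U0" and qW: "snd c q \<in> W" using q UU0 by (auto simp: U_def)
    show ?thesis
      using ind qW XY q0 line[OF q] unfolding im by (simp add: inv[OF q0])
  qed
  moreover have "openin M U" unfolding U_def by (rule chart_open_preimage[OF chart W(1)])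
  moreover have "p \<in> U" using U0(2,3) W(2) by (auto simp: U_def)
  ultimately show "\<exists>U (\<iota> :: 'a \<Rightarrow> (real ^ 2) \<times> (real ^ 2)).
    openin M U \<and> p \<in> U \<and> smooth_embedding_on M A U \<iota> \<and> has_induced_para_CR (\<iota> ` U) \<and>
    (\<forall>q\<in>U. differential A \<iota> q ` X q = induced_xy (\<iota> ` U) (\<iota> q) \<and>
           differential A \<iota> q ` Y q = induced_ab (\<iota> ` U) (\<iota> q))"
    using emb CR unfolding im[symmetric]
    by (intro exI[of _ U] exI[of _ "J \<circ> snd c"] conjI ballI) simp_all
qed

end
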